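(* For each integer $r \ge 5$ there is a rank-$r$ sparse paving matroid $K$, not representable over any field, together with a two-element subset $X$ of its ground set, such that there is no matroid $N$ on the set of circuits of $K/X$ satisfying the modular-pair condition for which $(K/X)^N$ is isomorphic to $K \setminus X$.
   Context: A matroid of rank $r$ is sparse paving if every $r$-element subset of its ground set is either a basis or a circuit-hyperplane (a set that is both a circuit and a hyperplane). For a matroid $M$ on ground set $E$ and a matroid $N$ whose ground set is the set of circuits of $M$, $N$ satisfies the modular-pair condition if whenever $C_1,C_2$ are circuits of $M$ with $|C_1\cup C_2| - r_M(C_1\cup C_2) = 2$, every circuit $C$ of $M$ contained in $C_1\cup C_2$ satisfies $C\in \operatorname{cl}_N(\{C_1,C_2\})$. In that case $M^N$ denotes the matroid on $E$ with rank function $r(Y) = r_M(Y) + r_N(\{C : C \text{ a circuit of } M \text{ with } C \subseteq Y\})$ for $Y\subseteq E$ (this is a matroid, indeed a lift of $M$). *)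

theory Defs
  imports "HOL-Algebra.Generated_Fields" "HOL-Algebra.Weak_Morphisms" "HOL-Library.Countable_Set"
begin

section \<open>Finite matroids\<close>

text \<open>
  A finite matroid is given by its ground set and its rank function, subject to the usual rank
  axioms. The values of \<open>rk M\<close> outside the subsets of \<open>ground M\<close> carry no information.
\<close>

record 'a rank_system =
  ground :: "'a set"
  rk :: "'a set \<Rightarrow> nat"

locale matroid =
  fixes M :: "'a rank_system"
  assumes finite_ground: "finite (ground M)"
    and rk_le_card: "Y \<subseteq> ground M \<Longrightarrow> rk M Y \<le> card Y"
    and rk_mono: "Y \<subseteq> Z \<Longrightarrow> Z \<subseteq> ground M \<Longrightarrow> rk M Y \<le> rk M Z"
    and rk_submodular: "Y \<subseteq> ground M \<Longrightarrow> Z \<subseteq> ground M \<Longrightarrow>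
      rk M (Y \<union> Z) + rk M (Y \<inter> Z) \<le> rk M Y + rk M Z"

definition matroid_rank :: "'a rank_system \<Rightarrow> nat" where
  "matroid_rank M = rk M (ground M)"

definition matroid_indep :: "'a rank_system \<Rightarrow> 'a set \<Rightarrow> bool" where
  "matroid_indep M S \<longleftrightarrow> S \<subseteq> ground M \<and> rk M S = card S"

definition matroid_basis :: "'a rank_system \<Rightarrow> 'a set \<Rightarrow> bool" where
  "matroid_basis M B \<longleftrightarrow> matroid_indep M B \<and> (\<forall>S. matroid_indep M S \<and> B \<subseteq> S \<longrightarrow> S = B)"

definition matroid_circuit :: "'a rank_system \<Rightarrow> 'a set \<Rightarrow> bool" where
  "matroid_circuit M C \<longleftrightarrow>
    C \<subseteq> ground M \<and> \<not> matroid_indep M C \<and> (\<forall>S. S \<subset> C \<longrightarrow> matroid_indep M S)"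

definition matroid_circuits :: "'a rank_system \<Rightarrow> 'a set set" where
  "matroid_circuits M = {C. matroid_circuit M C}"

definition matroid_closure :: "'a rank_system \<Rightarrow> 'a set \<Rightarrow> 'a set" where
  "matroid_closure M S = {e \<in> ground M. rk M (insert e S) = rk M S}"

definition matroid_flat :: "'a rank_system \<Rightarrow> 'a set \<Rightarrow> bool" where
  "matroid_flat M S \<longleftrightarrow> S \<subseteq> ground M \<and> matroid_closure M S = S"

definition matroid_hyperplane :: "'a rank_system \<Rightarrow> 'a set \<Rightarrow> bool" where
  "matroid_hyperplane M H \<longleftrightarrow> matroid_flat M H \<and> rk M H + 1 = matroid_rank M"

definition circuit_hyperplane :: "'a rank_system \<Rightarrow> 'a set \<Rightarrow> bool" where
  "circuit_hyperplane M S \<longleftrightarrow> matroid_circuit M S \<and> matroid_hyperplane M S"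

definition sparse_paving :: "'a rank_system \<Rightarrow> bool" where
  "sparse_paving M \<longleftrightarrow> (\<forall>S. S \<subseteq> ground M \<and> card S = matroid_rank M \<longrightarrow>
    matroid_basis M S \<or> circuit_hyperplane M S)"

definition matroid_delete :: "'a rank_system \<Rightarrow> 'a set \<Rightarrow> 'a rank_system" where
  "matroid_delete M X = \<lparr>ground = ground M - X, rk = rk M\<rparr>"

definition matroid_contract :: "'a rank_system \<Rightarrow> 'a set \<Rightarrow> 'a rank_system" where
  "matroid_contract M X = \<lparr>ground = ground M - X, rk = (\<lambda>Y. rk M (Y \<union> X) - rk M X)\<rparr>"

definition matroid_isomorphic :: "'a rank_system \<Rightarrow> 'b rank_system \<Rightarrow> bool" where
  "matroid_isomorphic M N \<longleftrightarrow>
    (\<exists>f. bij_betw f (ground M) (ground N) \<and> (\<forall>Y. Y \<subseteq> ground M \<longrightarrow> rk N (f ` Y) = rk M Y))"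

lemma (in matroid) matroid_matroid_delete: "matroid (matroid_delete M X)"
proof
  fix Y Z assume "Y \<subseteq> Z" "Z \<subseteq> ground (matroid_delete M X)"
  then show "rk (matroid_delete M X) Y \<le> rk (matroid_delete M X) Z"
    unfolding matroid_delete_def by (auto intro: rk_mono)
next
  fix Y Z assume "Y \<subseteq> ground (matroid_delete M X)" "Z \<subseteq> ground (matroid_delete M X)"
  then have "Y \<subseteq> ground M" "Z \<subseteq> ground M" unfolding matroid_delete_def by auto
  then show "rk (matroid_delete M X) (Y \<union> Z) + rk (matroid_delete M X) (Y \<inter> Z)
      \<le> rk (matroid_delete M X) Y + rk (matroid_delete M X) Z"
    unfolding matroid_delete_def using rk_submodular by simp
qed (use finite_ground rk_le_card in \<open>auto simp: matroid_delete_def\<close>)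

lemma (in matroid) matroid_matroid_contract:
  assumes X: "X \<subseteq> ground M"
  shows "matroid (matroid_contract M X)"
proof
  show "finite (ground (matroid_contract M X))"
    using finite_ground by (simp add: matroid_contract_def)
next
  fix Y assume "Y \<subseteq> ground (matroid_contract M X)"
  then have Y: "Y \<subseteq> ground M" by (auto simp: matroid_contract_def)
  then have "rk M (Y \<union> X) + rk M (Y \<inter> X) \<le> rk M Y + rk M X" using rk_submodular X by blast
  then show "rk (matroid_contract M X) Y \<le> card Y"
    using rk_le_card[OF Y] by (simp add: matroid_contract_def)
next
  fix Y Z assume *: "Y \<subseteq> Z" "Z \<subseteq> ground (matroid_contract M X)"
  then have "rk M (Y \<union> X) \<le> rk M (Z \<union> X)"
    using X by (intro rk_mono) (auto simp: matroid_contract_def)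
  then show "rk (matroid_contract M X) Y \<le> rk (matroid_contract M X) Z"
    by (simp add: matroid_contract_def)
next
  fix Y Z
  assume *: "Y \<subseteq> ground (matroid_contract M X)" "Z \<subseteq> ground (matroid_contract M X)"
  then have Y: "Y \<union> X \<subseteq> ground M" and Z: "Z \<union> X \<subseteq> ground M"
    using X by (auto simp: matroid_contract_def)
  have "rk M ((Y \<union> X) \<union> (Z \<union> X)) + rk M ((Y \<union> X) \<inter> (Z \<union> X)) \<le> rk M (Y \<union> X) + rk M (Z \<union> X)"
    by (rule rk_submodular[OF Y Z])
  moreover have "(Y \<union> X) \<union> (Z \<union> X) = (Y \<union> Z) \<union> X" "(Y \<union> X) \<inter> (Z \<union> X) = (Y \<inter> Z) \<union> X"
    by auto
  ultimately have main: "rk M ((Y \<union> Z) \<union> X) + rk M ((Y \<inter> Z) \<union> X) \<le> rk M (Y \<union> X) + rk M (Z \<union> X)"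
    by simp
  have "rk M X \<le> rk M ((Y \<union> Z) \<union> X)" "rk M X \<le> rk M ((Y \<inter> Z) \<union> X)"
    "rk M X \<le> rk M (Y \<union> X)" "rk M X \<le> rk M (Z \<union> X)"
    using Y Z by (auto intro!: rk_mono)
  then show "rk (matroid_contract M X) (Y \<union> Z) + rk (matroid_contract M X) (Y \<inter> Z)
      \<le> rk (matroid_contract M X) Y + rk (matroid_contract M X) Z"
    using main by (simp add: matroid_contract_def)
qed


section \<open>The lift construction\<close>

definition modular_pair_condition :: "'a rank_system \<Rightarrow> 'a set rank_system \<Rightarrow> bool" where
  "modular_pair_condition M N \<longleftrightarrow>
    (\<forall>C1 C2. matroid_circuit M C1 \<and> matroid_circuit M C2 \<and>
        card (C1 \<union> C2) - rk M (C1 \<union> C2) = 2 \<longrightarrow>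
      (\<forall>C. matroid_circuit M C \<and> C \<subseteq> C1 \<union> C2 \<longrightarrow> C \<in> matroid_closure N {C1, C2}))"

definition matroid_lift :: "'a rank_system \<Rightarrow> 'a set rank_system \<Rightarrow> 'a rank_system" where
  "matroid_lift M N =
    \<lparr>ground = ground M, rk = (\<lambda>Y. rk M Y + rk N {C. matroid_circuit M C \<and> C \<subseteq> Y})\<rparr>"


section \<open>Representability\<close>

text \<open>
  A representation of \<open>M\<close> over \<open>F\<close> assigns to each \<open>e\<close> in the ground set a vector \<open>v e\<close> of
  \<open>F\<close>-space of dimension \<open>n\<close>, whose coordinates are \<open>v e i\<close> for \<open>i < n\<close>, so that the independent
  sets of \<open>M\<close> are exactly those whose family of vectors is linearly independent. Independence is
  that of the family \<open>(v e)\<close>, \<open>e \<in> S\<close>, so that equal vectors at distinct elements are dependent.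
\<close>

definition lin_indep_family ::
    "('f, 'm) ring_scheme \<Rightarrow> nat \<Rightarrow> ('a \<Rightarrow> nat \<Rightarrow> 'f) \<Rightarrow> 'a set \<Rightarrow> bool" where
  "lin_indep_family F n v S \<longleftrightarrow>
    (\<forall>c. c \<in> S \<rightarrow> carrier F \<and> (\<forall>i<n. (\<Oplus>\<^bsub>F\<^esub>e\<in>S. c e \<otimes>\<^bsub>F\<^esub> v e i) = \<zero>\<^bsub>F\<^esub>) \<longrightarrow>
      (\<forall>e\<in>S. c e = \<zero>\<^bsub>F\<^esub>))"

definition representable_over :: "('f, 'm) ring_scheme \<Rightarrow> 'a rank_system \<Rightarrow> bool" where
  "representable_over F M \<longleftrightarrow>
    (\<exists>n v. (\<forall>e\<in>ground M. \<forall>i<n. v e i \<in> carrier F) \<and>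
      (\<forall>S. S \<subseteq> ground M \<longrightarrow> (matroid_indep M S \<longleftrightarrow> lin_indep_family F n v S)))"

text \<open>
  HOL cannot quantify over types inside a formula, so the field below ranges over the fields whose
  carrier is a set of natural numbers. Up to isomorphism these are all the countable fields, and
  this loses nothing: by the theorem \<open>representableI\<close> below, a matroid that is representable over
  a field with carrier in any type whatsoever is representable in this sense.
\<close>

definition representable :: "'a rank_system \<Rightarrow> bool" where
  "representable M \<longleftrightarrow> (\<exists>F :: nat ring. field F \<and> representable_over F M)"

lemma countable_generate_field:
  assumes "countable A"
  shows "countable (generate_field F A)"
proof -
  define step where "step S = S \<union> (\<lambda>x. \<ominus>\<^bsub>F\<^esub> x) ` S \<union> (\<lambda>x. inv\<^bsub>F\<^esub> x) ` S
    \<union> (\<lambda>(x, y). x \<oplus>\<^bsub>F\<^esub> y) ` (S \<times> S) \<union> (\<lambda>(x, y). x \<otimes>\<^bsub>F\<^esub> y) ` (S \<times> S)" for S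
  define T where "T k = (step ^^ k) (insert \<one>\<^bsub>F\<^esub> A)" for k
  have T0: "T 0 = insert \<one>\<^bsub>F\<^esub> A" and TS: "T (Suc k) = step (T k)" for k
    by (simp_all add: T_def)
  have cnt: "countable (T k)" for k
  proof (induction k)
    case 0
    show ?case using assms by (simp add: T0)
  next
    case (Suc k)
    then show ?case unfolding TS step_def
      by (intro countable_Un countable_image countable_SIGMA)
  qed
  have "T k \<subseteq> T (Suc k)" for k by (auto simp: TS step_def)
  then have mono: "T i \<subseteq> T j" if "i \<le> j" for i j
    using that by (rule lift_Suc_mono_le)
  have "x \<in> (\<Union>k. T k)" if "x \<in> generate_field F A" for x
    using that
  proof induction
    case one
    have "\<one>\<^bsub>F\<^esub> \<in> T 0" by (simp add: T0)
    then show ?case by blast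
  next
    case (incl h)
    then have "h \<in> T 0" by (simp add: T0)
    then show ?case by blast
  next
    case (a_inv h)
    then obtain k where "h \<in> T k" by blast
    then have "\<ominus>\<^bsub>F\<^esub> h \<in> T (Suc k)" by (auto simp: TS step_def)
    then show ?case by blast
  next
    case (m_inv h)
    then obtain k where "h \<in> T k" by blast
    then have "inv\<^bsub>F\<^esub> h \<in> T (Suc k)" by (auto simp: TS step_def)
    then show ?case by blast
  next
    case (eng_add x y)
    then obtain i j where "x \<in> T i" "y \<in> T j" by blast
    then have "x \<in> T (max i j)" "y \<in> T (max i j)"
      using mono[of i "max i j"] mono[of j "max i j"] by auto
    then have "x \<oplus>\<^bsub>F\<^esub> y \<in> T (Suc (max i j))" unfolding TS step_def by blast
    then show ?case by blast
  next
    case (eng_mult x y)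
    then obtain i j where "x \<in> T i" "y \<in> T j" by blast
    then have "x \<in> T (max i j)" "y \<in> T (max i j)"
      using mono[of i "max i j"] mono[of j "max i j"] by auto
    then have "x \<otimes>\<^bsub>F\<^esub> y \<in> T (Suc (max i j))" unfolding TS step_def by blast
    then show ?case by blast
  qed
  then have "generate_field F A \<subseteq> (\<Union>k. T k)" by blast
  moreover have "countable (\<Union>k. T k)" using cnt by blast
  ultimately show ?thesis by (rule countable_subset)
qed

lemma lin_indep_family_cong:
  assumes "cring R" and v: "\<And>e i. e \<in> A \<Longrightarrow> i < n \<Longrightarrow> v e i \<in> carrier R"
    and eq: "\<And>e i. e \<in> A \<Longrightarrow> i < n \<Longrightarrow> v e i = w e i"
    and indep: "lin_indep_family R n v A"
  shows "lin_indep_family R n w A"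
proof -
  interpret cring R by fact
  have "(\<Oplus>\<^bsub>R\<^esub>e\<in>A. c e \<otimes>\<^bsub>R\<^esub> w e i) = (\<Oplus>\<^bsub>R\<^esub>e\<in>A. c e \<otimes>\<^bsub>R\<^esub> v e i)"
    if c: "c \<in> A \<rightarrow> carrier R" and i: "i < n" for c i
  proof (rule finsum_cong'[OF refl])
    show "(\<lambda>e. c e \<otimes>\<^bsub>R\<^esub> v e i) \<in> A \<rightarrow> carrier R"
      using c v i by (auto simp: Pi_def)
    show "c e \<otimes>\<^bsub>R\<^esub> w e i = c e \<otimes>\<^bsub>R\<^esub> v e i" if "e \<in> A" for e
      using eq[OF that i] by simp
  qed
  then show ?thesis
    using indep unfolding lin_indep_family_def by metis
qed

lemma lin_indep_family_embed:
  assumes "cring R" "cring S" and h: "h \<in> ring_hom R S" "inj_on h (carrier R)"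
    and v: "\<And>e i. e \<in> A \<Longrightarrow> i < n \<Longrightarrow> v e i \<in> carrier R"
    and indep: "lin_indep_family S n (\<lambda>e i. h (v e i)) A"
  shows "lin_indep_family R n v A"
proof -
  interpret ring_hom_cring R S h
    using assms(1,2) h(1) by (simp add: ring_hom_cring_def ring_hom_cring_axioms_def)
  show ?thesis unfolding lin_indep_family_def
  proof (intro allI impI ballI; elim conjE)
    fix c e
    assume c: "c \<in> A \<rightarrow> carrier R" and e: "e \<in> A"
      and 0: "\<forall>i<n. (\<Oplus>\<^bsub>R\<^esub>e\<in>A. c e \<otimes>\<^bsub>R\<^esub> v e i) = \<zero>\<^bsub>R\<^esub>"
    have "(\<Oplus>\<^bsub>S\<^esub>e\<in>A. h (c e) \<otimes>\<^bsub>S\<^esub> h (v e i)) = \<zero>\<^bsub>S\<^esub>" if i: "i < n" for i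
    proof -
      have "(\<Oplus>\<^bsub>S\<^esub>e\<in>A. h (c e) \<otimes>\<^bsub>S\<^esub> h (v e i)) = (\<Oplus>\<^bsub>S\<^esub>e\<in>A. (h \<circ> (\<lambda>e. c e \<otimes>\<^bsub>R\<^esub> v e i)) e)"
        using c v i by (intro S.finsum_cong') (auto simp: Pi_def)
      also have "\<dots> = h (\<Oplus>\<^bsub>R\<^esub>e\<in>A. c e \<otimes>\<^bsub>R\<^esub> v e i)"
        using c v i by (intro hom_finsum[symmetric]) (auto simp: Pi_def)
      also have "\<dots> = \<zero>\<^bsub>S\<^esub>" using 0 i by simp
      finally show ?thesis .
    qed
    moreover have "(\<lambda>e. h (c e)) \<in> A \<rightarrow> carrier S" using c by (auto simp: Pi_def)
    ultimately have "h (c e) = \<zero>\<^bsub>S\<^esub>" using indep e unfolding lin_indep_family_def by blast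
    then show "c e = \<zero>\<^bsub>R\<^esub>"
      using h(2) c e by (metis PiE R.zero_closed hom_zero inj_onD)
  qed
qed

lemma representable_overI_countable_subfield:
  fixes F :: "('f, 'm) ring_scheme"
  assumes F: "field F" and fin: "finite (ground M)" and rep: "representable_over F M"
  obtains K where "subfield K F" "countable K" "representable_over (F\<lparr>carrier := K\<rparr>) M"
proof -
  interpret F: field F by (rule F)
  obtain n v where v: "\<And>e i. e \<in> ground M \<Longrightarrow> i < n \<Longrightarrow> v e i \<in> carrier F"
    and ind: "\<And>S. S \<subseteq> ground M \<Longrightarrow> matroid_indep M S \<longleftrightarrow> lin_indep_family F n v S"
    using rep unfolding representable_over_def by blast
  \<comment> \<open>The subfield is generated by all coordinates and, for each dependent set, the coefficients
    of one dependency.\<close>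
  have "\<forall>S. \<exists>c. \<not> lin_indep_family F n v S \<longrightarrow> c \<in> S \<rightarrow> carrier F \<and>
      (\<forall>i<n. (\<Oplus>\<^bsub>F\<^esub>e\<in>S. c e \<otimes>\<^bsub>F\<^esub> v e i) = \<zero>\<^bsub>F\<^esub>) \<and> (\<exists>e\<in>S. c e \<noteq> \<zero>\<^bsub>F\<^esub>)"
    unfolding lin_indep_family_def by blast
  then have "\<exists>c. \<forall>S. \<not> lin_indep_family F n v S \<longrightarrow> c S \<in> S \<rightarrow> carrier F \<and>
      (\<forall>i<n. (\<Oplus>\<^bsub>F\<^esub>e\<in>S. c S e \<otimes>\<^bsub>F\<^esub> v e i) = \<zero>\<^bsub>F\<^esub>) \<and> (\<exists>e\<in>S. c S e \<noteq> \<zero>\<^bsub>F\<^esub>)"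
    by (rule choice)
  then obtain c where "\<forall>S. \<not> lin_indep_family F n v S \<longrightarrow> c S \<in> S \<rightarrow> carrier F \<and>
      (\<forall>i<n. (\<Oplus>\<^bsub>F\<^esub>e\<in>S. c S e \<otimes>\<^bsub>F\<^esub> v e i) = \<zero>\<^bsub>F\<^esub>) \<and> (\<exists>e\<in>S. c S e \<noteq> \<zero>\<^bsub>F\<^esub>)"
    by (rule exE)
  then have c: "c S \<in> S \<rightarrow> carrier F"
    "i < n \<Longrightarrow> (\<Oplus>\<^bsub>F\<^esub>e\<in>S. c S e \<otimes>\<^bsub>F\<^esub> v e i) = \<zero>\<^bsub>F\<^esub>"
    "\<exists>e\<in>S. c S e \<noteq> \<zero>\<^bsub>F\<^esub>" if "\<not> lin_indep_family F n v S" for S i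
    using that by simp_all
  define D where "D = {S. S \<subseteq> ground M \<and> \<not> lin_indep_family F n v S}"
  define A where "A = (\<Union>e\<in>ground M. v e ` {..<n}) \<union> (\<Union>S\<in>D. c S ` S)"
  define K where "K = generate_field F A"
  have finD: "finite D" using fin by (simp add: D_def)
  have finA: "finite A"
  proof -
    have "finite (c S ` S)" if "S \<in> D" for S
      using that fin finite_subset[of S "ground M"] by (simp add: D_def)
    then show ?thesis unfolding A_def using fin finD by simp
  qed
  have A: "A \<subseteq> carrier F" 
  proof -
    have "c S ` S \<subseteq> carrier F" if "S \<in> D" for S
      using c(1)[of S] that by (auto simp: D_def)
    moreover have "v e ` {..<n} \<subseteq> carrier F" if "e \<in> ground M" for e using v that by auto
    ultimately show ?thesis unfolding A_def by blast
  qed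
  have K: "subfield K F" unfolding K_def by (rule F.generate_field_is_subfield[OF A])
  have cK: "countable K"
    unfolding K_def using finA by (intro countable_generate_field countable_finite)
  have AK: "A \<subseteq> K" unfolding K_def by (auto intro: generate_field.incl)
  have KF: "K \<subseteq> carrier F" using K by (rule subfieldE(3))
  let ?K = "F\<lparr>carrier := K\<rparr>"
  interpret K: field ?K by (rule F.subfield_iff(2)[OF K])
  have hom: "(\<lambda>x. x) \<in> ring_hom ?K F" using KF by (auto intro!: ring_hom_memI)
  interpret ring_hom_cring ?K F "\<lambda>x. x"
    using hom by unfold_locales simp
  have vK: "v e i \<in> K" if "e \<in> ground M" "i < n" for e i
    using that AK unfolding A_def by blast
  have "representable_over ?K M" unfolding representable_over_def
  proof (intro exI[of _ n] exI[of _ v] conjI ballI allI impI iffI)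
    fix S assume S: "S \<subseteq> ground M" and "matroid_indep M S"
    then have "lin_indep_family F n v S" using ind by blast
    then show "lin_indep_family ?K n v S"
      using S vK by (intro lin_indep_family_embed[OF K.is_cring F.is_cring hom]) auto
  next
    fix S assume S: "S \<subseteq> ground M" and L: "lin_indep_family ?K n v S"
    show "matroid_indep M S"
    proof (rule ccontr)
      assume "\<not> matroid_indep M S"
      then have dep: "\<not> lin_indep_family F n v S" using ind S by blast
      then have cS: "c S \<in> S \<rightarrow> K" using S AK unfolding A_def D_def by blast
      have "(\<Oplus>\<^bsub>?K\<^esub>e\<in>S. c S e \<otimes>\<^bsub>?K\<^esub> v e i) = \<zero>\<^bsub>?K\<^esub>" if i: "i < n" for i
      proof -
        have "(\<lambda>e. c S e \<otimes>\<^bsub>?K\<^esub> v e i) \<in> S \<rightarrow> carrier ?K"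
          using cS vK S i K.m_closed by (auto simp: Pi_def)
        from hom_finsum[OF this] show ?thesis using c(2)[OF dep i] by (simp add: o_def)
      qed
      then have "\<forall>e\<in>S. c S e = \<zero>\<^bsub>?K\<^esub>" using L cS unfolding lin_indep_family_def by auto
      then show False using c(3)[OF dep] by auto
    qed
  qed (use vK in auto)
  then show ?thesis using that K cK by blast
qed

theorem representableI:
  fixes F :: "('f, 'm) ring_scheme"
  assumes "field F" and "finite (ground M)" and "representable_over F M"
  shows "representable M"
proof -
  obtain K where K: "subfield K F" "countable K" and rep: "representable_over (F\<lparr>carrier := K\<rparr>) M"
    using representable_overI_countable_subfield[OF assms] by blast
  interpret F: field F by fact
  let ?K = "F\<lparr>carrier := K\<rparr>"
  interpret K: field ?K by (rule F.subfield_iff(2)[OF K(1)])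
  define g where "g = to_nat_on K"
  define G where "G = image_ring g ?K"
  have inj: "inj_on g (carrier ?K)" using K(2) by (simp add: g_def inj_on_to_nat_on)
  have iso: "g \<in> ring_iso ?K G" unfolding G_def by (rule inj_imp_image_ring_iso[OF inj])
  have G: "field G" unfolding G_def by (rule K.inj_imp_image_ring_is_field[OF inj])
  interpret G: field G by (rule G)
  define h where "h = inv_into (carrier ?K) g"
  have iso': "h \<in> ring_iso G ?K" unfolding h_def by (rule ring_iso_set_sym[OF K.ring_axioms iso])
  have hg: "h (g x) = x" if "x \<in> carrier ?K" for x
    unfolding h_def by (rule inv_into_f_f[OF inj that])
  have homs: "g \<in> ring_hom ?K G" "h \<in> ring_hom G ?K" "inj_on h (carrier G)"
    using iso iso' by (auto simp: ring_iso_def bij_betw_def)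
  obtain n v where v: "\<And>e i. e \<in> ground M \<Longrightarrow> i < n \<Longrightarrow> v e i \<in> carrier ?K"
    and ind: "\<And>S. S \<subseteq> ground M \<Longrightarrow> matroid_indep M S \<longleftrightarrow> lin_indep_family ?K n v S"
    using rep unfolding representable_over_def by blast
  have "representable_over G M" unfolding representable_over_def
  proof (intro exI[of _ n] exI[of _ "\<lambda>e i. g (v e i)"] conjI ballI allI impI)
    fix e i assume "e \<in> ground M" "i < n"
    then show "g (v e i) \<in> carrier G" by (intro ring_hom_closed[OF homs(1)] v)
  next
    fix S assume S: "S \<subseteq> ground M"
    then have vS: "v e i \<in> carrier ?K" if "e \<in> S" "i < n" for e i using v that by blast
    have "lin_indep_family ?K n v S" if "lin_indep_family G n (\<lambda>e i. g (v e i)) S"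
      by (rule lin_indep_family_embed[OF K.is_cring G.is_cring homs(1) inj vS that])
    moreover have "lin_indep_family G n (\<lambda>e i. g (v e i)) S" if *: "lin_indep_family ?K n v S"
    proof (rule lin_indep_family_embed[OF G.is_cring K.is_cring homs(2,3)])
      show "lin_indep_family ?K n (\<lambda>e i. h (g (v e i))) S"
      proof (rule lin_indep_family_cong[OF K.is_cring _ _ *])
        show "v e i \<in> carrier ?K" if "e \<in> S" "i < n" for e i by (rule vS[OF that])
        show "v e i = h (g (v e i))" if "e \<in> S" "i < n" for e i by (rule hg[OF vS[OF that], symmetric])
      qed
      show "g (v e i) \<in> carrier G" if "e \<in> S" "i < n" for e i
        by (rule ring_hom_closed[OF homs(1) vS[OF that]])
    qed
    ultimately show "matroid_indep M S \<longleftrightarrow> lin_indep_family G n (\<lambda>e i. g (v e i)) S"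
      using ind[OF S] by blast
  qed
  then show ?thesis using G unfolding representable_def by blast
qed

end

(*
  Let K be the sparse paving matroid on V + X with |X| = 2 whose circuit-hyperplanes are the sets
  S + X for S in a family SS of (r-2)-subsets of V, together with a family HH of r-subsets of V.
  The members of SS are circuits of K/X and are not loops of N.  For S1, S2 in SS whose union is
  an r-set, the modular-pair condition forces N to have rank 1 on {S1, S2} if that union is in HH
  in K\X and rank 2 otherwise.  As being parallel is transitive, there is no N as soon as
  S1 u S2 and S2 u S3 are in HH but S1 u S3 is an r-set not in HH.  Up to the isomorphism f, SS and
  HH may be identified by any permutation of V, so such a path has to exist for every relabelling;
  for the identity it makes K a Vamos-like matroid and hence not representable.

  SS consists of the (r-2)-sets with sum divisible by |V| = n.  Fix r-5 points Z of V and let HH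
  consist of the sets H + Z with H in a family of 5-subsets of E = V - Z; then, for each
  relabelling, only the triples W of E with W + Z in SS matter, and they form a partial triple
  system in which every point lies in about n/2 triples.  The family of 5-sets is found by the
  probabilistic method: add greedily T = 128 d^3 random stars {S + P_1, ..., S + P_d}, with S a
  triple and the P_j pairs, n being about 48 d.  For a given relabelling a star completes a path with
  probability of order 1/d, unless earlier 5-sets conflict with too many of the relevant ones, so
  no path arises with probability at most exp (- c d^2).  This beats the n^n relabellings.
*)
theory Submission
  imports Defs "HOL-Library.FuncSet" "HOL-Number_Theory.Cong" "HOL-Real_Asymp.Real_Asymp"
begin

section \<open>Sparse paving matroids without a lift presentation\<close>

text \<open>A path needs two 5-sets through the same triple. If 5-sets were drawn one at a time, a
  path would be a collision between distant steps; drawing them as petals of one star makes it an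
  event of a single step, whose probability is bounded below conditionally on the whole past. The
  past does harm in one way only: to keep the family spread, a 5-set is rejected when it shares four
  points with an earlier one. For a given relabelling, of order d^3 combinations of a triple and a
  petal matter. A star spoils O(1) of them on average, so of order d^3 stars can be drawn with at
  most a quarter of the combinations lost, and d^3 trials with success rate 1/d give the exponent
  d^2. The loss is controlled by a bound that ignores rejections; it is a sum of independent terms
  and therefore concentrates. Residues serve because a condition on the sum determines the last
  point of a set injectively. So two sets never differ by a single exchange, and, whatever the
  relabelling, enough triples lie across \<open>A\<close> and \<open>B\<close> and inside
  \<open>B\<close>.\<close>

definition spread :: "nat \<Rightarrow> 'a set set \<Rightarrow> bool" where
  "spread k \<D> \<longleftrightarrow> (\<forall>D\<in>\<D>. finite D \<and> card D = k) \<and>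
    (\<forall>D\<in>\<D>. \<forall>D'\<in>\<D>. D \<noteq> D' \<longrightarrow> card (D \<inter> D') + 2 \<le> k)"

text \<open>The uniform matroid of rank \<open>r\<close> in which the members of \<open>\<D>\<close>
  have been turned into circuit-hyperplanes.\<close>

definition paving :: "'a set \<Rightarrow> nat \<Rightarrow> 'a set set \<Rightarrow> 'a rank_system" where
  "paving V r \<D> = \<lparr>ground = V, rk = (\<lambda>Y. min (card Y) r - (if Y \<in> \<D> then 1 else 0))\<rparr>"

text \<open>The strict bound on \<open>r\<close> gives the whole ground set rank \<open>r\<close>;
  with \<open>card V = r\<close> and \<open>V \<in> \<D>\<close> it would drop to
  \<open>r - 1\<close>.\<close>

locale sparse_paving_data =
  fixes V :: "'a set" and r :: nat and \<D> :: "'a set set"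
  assumes finV: "finite V" and sprd: "spread r \<D>" and sub: "\<D> \<subseteq> Pow V" and cardV: "r < card V" and r1: "1 \<le> r"
begin

lemma ground_paving [simp]: "ground (paving V r \<D>) = V"
  by (simp add: paving_def)

lemma rk_paving: "rk (paving V r \<D>) Y = min (card Y) r - (if Y \<in> \<D> then 1 else 0)"
  by (simp add: paving_def)

lemma cardD: "D \<in> \<D> \<Longrightarrow> card D = r"
  using sprd by (simp add: spread_def)

lemma rk_small: "card Y < r \<Longrightarrow> rk (paving V r \<D>) Y = card Y"
  using cardD by (auto simp: rk_paving)

lemma rk_large: "r < card Y \<Longrightarrow> rk (paving V r \<D>) Y = r"
  using cardD by (auto simp: rk_paving)

lemma rk_in: "D \<in> \<D> \<Longrightarrow> rk (paving V r \<D>) D = r - 1"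
  using cardD by (auto simp: rk_paving)

lemma rk_notin: "card Y = r \<Longrightarrow> Y \<notin> \<D> \<Longrightarrow> rk (paving V r \<D>) Y = r"
  by (auto simp: rk_paving)

text \<open>Submodularity is at stake only for incomparable sets. Two members of \<open>\<D>\<close>
  have rank sum \<open>2 * r - 2\<close>, and spreading bounds their intersection by
  \<open>r - 2\<close>. If one set lies in \<open>\<D>\<close>, its lost unit is recovered because
  the intersection is strictly smaller than both sets. Otherwise the ranks are those of a uniform
  matroid.\<close>

lemma matroid_paving: "matroid (paving V r \<D>)"
proof
  show "finite (ground (paving V r \<D>))" using finV by simp
next
  fix Y show "rk (paving V r \<D>) Y \<le> card Y" by (simp add: rk_paving)
next
  fix Y Z assume "Y \<subseteq> Z" and Z: "Z \<subseteq> ground (paving V r \<D>)"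
  then have fin: "finite Z" using finV finite_subset by auto
  show "rk (paving V r \<D>) Y \<le> rk (paving V r \<D>) Z"
  proof (cases "Y = Z")
    case False
    then have "card Y < card Z" using \<open>Y \<subseteq> Z\<close> fin by (simp add: psubsetI psubset_card_mono)
    then show ?thesis using cardD by (auto simp: rk_paving)
  qed simp
next
  fix Y Z assume Y: "Y \<subseteq> ground (paving V r \<D>)" and Z: "Z \<subseteq> ground (paving V r \<D>)"
  then have fin: "finite Y" "finite Z" using finV finite_subset by auto
  let ?R = "rk (paving V r \<D>)"
  show "?R (Y \<union> Z) + ?R (Y \<inter> Z) \<le> ?R Y + ?R Z"
  proof (cases "Y \<subseteq> Z \<or> Z \<subseteq> Y")
    case True
    then show ?thesis by (elim disjE) (simp_all add: Un_absorb1 Un_absorb2 Int_absorb1 Int_absorb2)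
  next
    case False
    have c: "card (Y \<union> Z) + card (Y \<inter> Z) = card Y + card Z" using card_Un_Int[OF fin] by simp
    have "Y \<inter> Z \<subset> Y" "Y \<inter> Z \<subset> Z" using False by blast+
    then have lt: "card (Y \<inter> Z) < card Y" "card (Y \<inter> Z) < card Z"
      using fin psubset_card_mono by metis+
    have le: "?R (Y \<union> Z) \<le> min (card (Y \<union> Z)) r" "?R (Y \<inter> Z) \<le> min (card (Y \<inter> Z)) r"
      unfolding rk_paving by (rule diff_le_self)+
    consider "Y \<in> \<D>" "Z \<in> \<D>" | "Y \<in> \<D>" "Z \<notin> \<D>" | "Y \<notin> \<D>" "Z \<in> \<D>" | "Y \<notin> \<D>" "Z \<notin> \<D>" by blast
    then show ?thesis
    proof cases
      case 1
      have "Y \<noteq> Z" using False by blast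
      then have "card (Y \<inter> Z) + 2 \<le> r" using sprd 1 unfolding spread_def by blast
      then show ?thesis using le rk_in[OF 1(1)] rk_in[OF 1(2)] by linarith
    next
      case 2
      have "?R Z = min (card Z) r" using 2 by (simp add: rk_paving)
      then show ?thesis using le lt cardD[OF 2(1)] rk_in[OF 2(1)] r1 by linarith
    next
      case 3
      have "?R Y = min (card Y) r" using 3 by (simp add: rk_paving)
      then show ?thesis using le lt cardD[OF 3(2)] rk_in[OF 3(2)] r1 by linarith
    next
      case 4
      then have "?R Y = min (card Y) r" "?R Z = min (card Z) r" by (simp_all add: rk_paving)
      then show ?thesis using le lt c by linarith
    qed
  qed
qed

lemma rank_paving: "matroid_rank (paving V r \<D>) = r"
  using rk_large[OF cardV] by (simp add: matroid_rank_def)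

lemma indep_paving:
  "matroid_indep (paving V r \<D>) S \<longleftrightarrow> S \<subseteq> V \<and> card S \<le> r \<and> S \<notin> \<D>"
  using cardD[of S] r1 by (auto simp: matroid_indep_def rk_paving min_def split: if_splits)

lemma circuit_D:
  assumes "D \<in> \<D>" shows "matroid_circuit (paving V r \<D>) D"
proof -
  have "matroid_indep (paving V r \<D>) S" if "S \<subset> D" for S
  proof -
    have "finite D" using assms sub finV finite_subset by blast
    then have "card S < r" using that cardD[OF assms] psubset_card_mono by blast
    then show ?thesis using that assms sub cardD[of S] by (auto simp: indep_paving)
  qed
  then show ?thesis using assms sub unfolding matroid_circuit_def by (auto simp: indep_paving)
qed

lemma sparse_paving_paving: "sparse_paving (paving V r \<D>)"
  unfolding sparse_paving_def rank_paving ground_paving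
proof (intro allI impI)
  fix S assume S: "S \<subseteq> V \<and> card S = r"
  show "matroid_basis (paving V r \<D>) S \<or> circuit_hyperplane (paving V r \<D>) S"
  proof (cases "S \<in> \<D>")
    case False
    have "T = S" if "matroid_indep (paving V r \<D>) T" "S \<subseteq> T" for T
    proof -
      have "finite T" "card T \<le> card S"
        using that finV S by (auto simp: indep_paving dest: finite_subset)
      then show "T = S" using that(2) by (metis card_seteq)
    qed
    then show ?thesis using S False by (auto simp: matroid_basis_def indep_paving)
  next
    case True
    have "e \<in> S" if "e \<in> V" "rk (paving V r \<D>) (insert e S) = rk (paving V r \<D>) S" for e
    proof (rule ccontr)
      assume "e \<notin> S"
      then have "card (insert e S) = Suc r" using S finV finite_subset by (metis card_insert_disjoint)
      then show False using that rk_large[of "insert e S"] rk_in[OF True] r1 by simp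
    qed
    then have "matroid_flat (paving V r \<D>) S"
      using S by (auto simp: matroid_flat_def matroid_closure_def insert_absorb)
    then show ?thesis
      using circuit_D[OF True] rk_in[OF True] r1
      by (simp add: circuit_hyperplane_def matroid_hyperplane_def rank_paving)
  qed
qed

end

text \<open>Closure is defined by adding one element; submodularity allows the elements to be added
  successively. This lets the rank of all circuits inside a union be read off from the modular
  pair.\<close>

lemma (in matroid) rk_subset_closure:
  assumes S: "S \<subseteq> ground M" and C: "C \<subseteq> matroid_closure M S"
  shows "rk M (S \<union> C) = rk M S"
proof -
  have CG: "C \<subseteq> ground M" using C by (auto simp: matroid_closure_def)
  then have "finite C" using finite_ground finite_subset by blast
  then show ?thesis using C CG
  proof induction
    case (insert e C)
    have e: "e \<in> ground M" "rk M (insert e S) = rk M S"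
      using insert.prems by (auto simp: matroid_closure_def)
    have "rk M ((S \<union> C) \<union> insert e S) + rk M ((S \<union> C) \<inter> insert e S) \<le> rk M (S \<union> C) + rk M (insert e S)"
      using S insert.prems by (intro rk_submodular) auto
    moreover have "rk M S \<le> rk M ((S \<union> C) \<inter> insert e S)"
      using S insert.prems by (intro rk_mono) auto
    moreover have "rk M S \<le> rk M (S \<union> insert e C)"
      using S insert.prems by (intro rk_mono) auto
    moreover have "(S \<union> C) \<union> insert e S = S \<union> insert e C" by auto
    ultimately show ?case using insert e by simp
  qed simp
qed

section \<open>Linear relations among a family of vectors\<close>

definition dependency ::
    "('f, 'm) ring_scheme \<Rightarrow> nat \<Rightarrow> ('a \<Rightarrow> nat \<Rightarrow> 'f) \<Rightarrow> 'a set \<Rightarrow> ('a \<Rightarrow> 'f) \<Rightarrow> bool" where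
  "dependency F n v E c \<longleftrightarrow> c \<in> E \<rightarrow> carrier F \<and> (\<forall>i<n. (\<Oplus>\<^bsub>F\<^esub>e\<in>E. c e \<otimes>\<^bsub>F\<^esub> v e i) = \<zero>\<^bsub>F\<^esub>)"

lemma lin_indep_family_dependency:
  assumes "lin_indep_family F n v E" "dependency F n v E c" "e \<in> E"
  shows "c e = \<zero>\<^bsub>F\<^esub>"
  using assms unfolding lin_indep_family_def dependency_def by blast

context cring
begin

text \<open>Relations on different subsets become comparable once they are extended by zero to the
  whole ground set, where they can be combined.\<close>

lemma dependency_restrict_iff:
  assumes "finite E" "S \<subseteq> E" and v: "\<And>e i. e \<in> E \<Longrightarrow> i < n \<Longrightarrow> v e i \<in> carrier R"
    and c: "c \<in> E \<rightarrow> carrier R" "\<And>e. e \<in> E - S \<Longrightarrow> c e = \<zero>"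
  shows "dependency R n v E c \<longleftrightarrow> dependency R n v S c"
proof -
  have "(\<Oplus>e\<in>S. c e \<otimes> v e i) = (\<Oplus>e\<in>E. c e \<otimes> v e i)" if "i < n" for i
    by (rule add.finprod_mono_neutral_cong_left)
       (use assms that in \<open>auto simp: Pi_def\<close>)
  then show ?thesis using c assms(2) unfolding dependency_def by (auto simp: Pi_def)
qed

lemma dependency_combination:
  assumes "finite E" and v: "\<And>e i. e \<in> E \<Longrightarrow> i < n \<Longrightarrow> v e i \<in> carrier R"
    and c: "dependency R n v E c" "dependency R n v E c'" and ab: "a \<in> carrier R" "b \<in> carrier R"
  shows "dependency R n v E (\<lambda>e. a \<otimes> c e \<ominus> b \<otimes> c' e)"
proof -
  have cc: "c e \<in> carrier R" "c' e \<in> carrier R" if "e \<in> E" for e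
    using c that by (auto simp: dependency_def)
  have "(\<Oplus>e\<in>E. (a \<otimes> c e \<ominus> b \<otimes> c' e) \<otimes> v e i) = \<zero>" if i: "i < n" for i
  proof -
    have "(\<Oplus>e\<in>E. (a \<otimes> c e \<ominus> b \<otimes> c' e) \<otimes> v e i)
        = (\<Oplus>e\<in>E. a \<otimes> (c e \<otimes> v e i) \<oplus> (\<ominus> b) \<otimes> (c' e \<otimes> v e i))"
      using cc v[OF _ i] ab
      by (intro finsum_cong') (auto simp: minus_eq l_distr m_assoc l_minus)
    also have "\<dots> = a \<otimes> (\<Oplus>e\<in>E. c e \<otimes> v e i) \<oplus> (\<ominus> b) \<otimes> (\<Oplus>e\<in>E. c' e \<otimes> v e i)"
      using cc v[OF _ i] ab assms(1)
      by (subst finsum_addf) (auto simp: finsum_rdistr)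
    also have "\<dots> = \<zero>" using c i ab by (auto simp: dependency_def)
    finally show ?thesis .
  qed
  then show ?thesis using cc ab by (auto simp: dependency_def)
qed

end


section \<open>The matroid \<open>K\<close>: obstructions to a lift presentation and to
  representability\<close>

locale lift_data =
  fixes V X :: "'a set" and r :: nat and \<S> \<H> :: "'a set set"
  assumes finite_V: "finite V" and X: "card X = 2" "V \<inter> X = {}" and r: "4 \<le> r"
    and \<S>: "spread (r - 2) \<S>" "\<S> \<subseteq> Pow V" and \<H>: "spread r \<H>" "\<H> \<subseteq> Pow V"
    and large: "r < card V + 2"
begin

definition "\<D> = (\<lambda>S. S \<union> X) ` \<S> \<union> \<H>"

definition "K = paving (V \<union> X) r \<D>"

lemma finite_X: "finite X" using X(1) card.infinite by force

lemma card_S: "S \<in> \<S> \<Longrightarrow> card S = r - 2" and card_H: "H \<in> \<H> \<Longrightarrow> card H = r"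
  using \<S> \<H> by (auto simp: spread_def)

lemma finite_sub: "Y \<subseteq> V \<Longrightarrow> finite Y" using finite_V finite_subset by blast

lemma card_Un_X: "Y \<subseteq> V \<Longrightarrow> card (Y \<union> X) = card Y + 2"
  using finite_sub finite_X X by (subst card_Un_disjoint) auto

lemma in_D_iff: "Y \<subseteq> V \<Longrightarrow> Y \<in> \<D> \<longleftrightarrow> Y \<in> \<H>"
proof -
  assume Y: "Y \<subseteq> V"
  have "X \<noteq> {}" using X by auto
  then have "S \<union> X \<noteq> Y" for S using Y X(2) by blast
  then show ?thesis unfolding \<D>_def by blast
qed

lemma Un_X_in_D: "S \<in> \<S> \<Longrightarrow> S \<union> X \<in> \<D>"
  by (auto simp: \<D>_def)

text \<open>A set \<open>S \<union> X\<close> meets a member of \<open>\<H>\<close> inside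
  \<open>S\<close>, whose size \<open>r - 2\<close> is already the permitted bound; between two sets
  containing \<open>X\<close>, both sides of the bound for \<open>\<S>\<close> grow by 2.\<close>

lemma spread_D: "spread r \<D>"
proof -
  have c1: "card D = r \<and> finite D" if "D \<in> \<D>" for D
    using that card_Un_X \<S>(2) card_S \<H> r finite_X finite_sub by (auto simp: \<D>_def spread_def)
  have SH: "card ((S \<union> X) \<inter> H) + 2 \<le> r" if "S \<in> \<S>" "H \<in> \<H>" for S H
  proof -
    have "S \<subseteq> V" "H \<subseteq> V" using that \<S> \<H> by auto
    then have "S \<subseteq> V" "(S \<union> X) \<inter> H \<subseteq> S" using X(2) by blast+
    then have "card ((S \<union> X) \<inter> H) \<le> card S" using finite_sub card_mono by metis
    then show ?thesis using card_S[OF that(1)] r by simp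
  qed
  have SS: "card ((S \<union> X) \<inter> (S' \<union> X)) + 2 \<le> r" if "S \<in> \<S>" "S' \<in> \<S>" "S \<noteq> S'" for S S'
  proof -
    have "card (S \<inter> S' \<union> X) = card (S \<inter> S') + 2" using that \<S> by (intro card_Un_X) auto
    moreover have "card (S \<inter> S') + 2 \<le> r - 2" using that \<S>(1) by (auto simp: spread_def)
    moreover have "(S \<union> X) \<inter> (S' \<union> X) = S \<inter> S' \<union> X" by auto
    ultimately show ?thesis using r by simp
  qed
  have HH: "card (H \<inter> H') + 2 \<le> r" if "H \<in> \<H>" "H' \<in> \<H>" "H \<noteq> H'" for H H'
    using that \<H>(1) by (auto simp: spread_def)
  have "card (D \<inter> D') + 2 \<le> r" if DD: "D \<in> \<D>" "D' \<in> \<D>" "D \<noteq> D'" for D D'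
  proof -
    consider S S' where "S \<in> \<S>" "S' \<in> \<S>" "D = S \<union> X" "D' = S' \<union> X"
      | S where "S \<in> \<S>" "D = S \<union> X" "D' \<in> \<H>" | S where "S \<in> \<S>" "D' = S \<union> X" "D \<in> \<H>"
      | "D \<in> \<H>" "D' \<in> \<H>" using DD(1,2) unfolding \<D>_def by blast
    then show ?thesis
    proof cases
      case 1 then show ?thesis using SS DD(3) by blast
    next
      case 2 then show ?thesis using SH by blast
    next
      case 3 then show ?thesis using SH[of S D] by (simp add: Int_commute)
    next
      case 4 then show ?thesis using HH DD(3) by blast
    qed
  qed
  then show ?thesis using c1 unfolding spread_def by blast
qed

sublocale sparse_paving_data "V \<union> X" r \<D>
proof
  show "\<D> \<subseteq> Pow (V \<union> X)" using \<S> \<H> by (auto simp: \<D>_def)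
  show "r < card (V \<union> X)" using large card_Un_X[of V] by simp
qed (use finite_V finite_X spread_D r in auto)

lemma rk_X: "rk K X = 2" using r X unfolding K_def by (simp add: rk_small)

lemma ground_contract: "ground (matroid_contract K X) = V"
  using X by (auto simp: matroid_contract_def K_def)

lemma contract_circuit:
  assumes "S \<in> \<S>" shows "matroid_circuit (matroid_contract K X) S"
proof -
  let ?M = "matroid_contract K X"
  have SV: "S \<subseteq> V" using assms \<S> by auto
  have "rk K (S \<union> X) = r - 1" unfolding K_def by (rule rk_in[OF Un_X_in_D[OF assms]])
  then have "rk ?M S < card S" using card_S[OF assms] r rk_X by (simp add: matroid_contract_def)
  then have "\<not> matroid_indep ?M S" by (simp add: matroid_indep_def)
  moreover have "matroid_indep ?M T" if "T \<subset> S" for T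
  proof -
    have "card T < card S" using that SV finite_sub psubset_card_mono by blast
    moreover have "card (T \<union> X) = card T + 2" using that SV by (intro card_Un_X) auto
    ultimately have "rk K (T \<union> X) = card T + 2"
      using card_S[OF assms] unfolding K_def by (subst rk_small) auto
    then show ?thesis
      using that SV unfolding matroid_indep_def ground_contract rk_X[symmetric]
      by (auto simp: matroid_contract_def rk_X)
  qed
  ultimately show ?thesis using SV unfolding matroid_circuit_def ground_contract by blast
qed

text \<open>An \<open>r\<close>-subset of \<open>V\<close> has rank \<open>r - 2\<close> in the
  contraction, so its circuits have rank 1 or 2 in \<open>N\<close> according to whether its image
  is in \<open>\<H>\<close>. For the two unions in \<open>\<H>\<close> monotonicity bounds the rank
  of the pair by 1; for \<open>{S1, S3}\<close> the modular-pair condition is what bounds it below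
  by 2. Submodularity on \<open>{S1, S2}\<close> and \<open>{S2, S3}\<close>, which share the
  nonloop \<open>S2\<close>, gives the contradiction.\<close>

lemma no_lift:
  assumes N: "matroid N" "ground N = matroid_circuits (matroid_contract K X)"
    and mod: "modular_pair_condition (matroid_contract K X) N"
    and f: "\<And>Y. Y \<subseteq> V \<Longrightarrow> rk K (f ` Y) = rk (matroid_lift (matroid_contract K X) N) Y"
      "bij_betw f V V"
    and S: "S1 \<in> \<S>" "S2 \<in> \<S>" "S3 \<in> \<S>"
    and H: "f ` (S1 \<union> S2) \<in> \<H>" "f ` (S2 \<union> S3) \<in> \<H>" "f ` (S1 \<union> S3) \<notin> \<H>" "card (S1 \<union> S3) = r"
  shows False
proof -
  let ?M = "matroid_contract K X"
  interpret N: matroid N by (rule N(1))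
  define \<C> where "\<C> Y = {C. matroid_circuit ?M C \<and> C \<subseteq> Y}" for Y
  have \<C>_ground: "\<C> Y \<subseteq> ground N" for Y using N(2) by (auto simp: \<C>_def matroid_circuits_def)
  have SV: "S1 \<subseteq> V" "S2 \<subseteq> V" "S3 \<subseteq> V" using S \<S> by auto
  have circ: "matroid_circuit ?M S1" "matroid_circuit ?M S2" "matroid_circuit ?M S3"
    using contract_circuit S by auto
  have card_f: "card (f ` Y) = card Y" "f ` Y \<subseteq> V" if "Y \<subseteq> V" for Y
    using f(2) that by (auto simp: bij_betw_def card_image inj_on_subset)
  have lift: "rk N (\<C> Y) = rk K (f ` Y) - rk ?M Y" if "Y \<subseteq> V" for Y
    using f(1)[OF that] by (simp add: matroid_lift_def \<C>_def)
  have rkM: "rk ?M Y = r - 2" if "Y \<subseteq> V" "card Y = r" for Y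
  proof -
    have "rk K (Y \<union> X) = r" unfolding K_def using that card_Un_X by (intro rk_large) simp
    then show ?thesis using rk_X by (simp add: matroid_contract_def)
  qed
  have rkK: "rk K (f ` Y) = (if f ` Y \<in> \<H> then r - 1 else r)" if "Y \<subseteq> V" "card Y = r" for Y
    using that card_f[of Y] in_D_iff[of "f ` Y"] rk_in[of "f ` Y"] rk_notin[of "f ` Y"]
    unfolding K_def by auto
  have H': "card (S1 \<union> S2) = r" "card (S2 \<union> S3) = r"
    using H card_H card_f[of "S1 \<union> S2"] card_f[of "S2 \<union> S3"] SV by auto
  have "rk N (\<C> (S1 \<union> S2)) = 1" "rk N (\<C> (S2 \<union> S3)) = 1" "rk N (\<C> (S1 \<union> S3)) = 2"
    using lift rkM rkK SV H H' r by auto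
  moreover have "rk N {S1, S2} \<le> rk N (\<C> (S1 \<union> S2))" "rk N {S2, S3} \<le> rk N (\<C> (S2 \<union> S3))"
    using circ \<C>_ground by (auto intro!: N.rk_mono simp: \<C>_def)
  \<comment> \<open>\<open>S2\<close> is the only circuit inside itself, and its rank drops from
    \<open>r - 2\<close> in \<open>K\<close> to \<open>r - 3\<close> in the contraction.\<close>
  moreover have "rk N {S2} = 1"
  proof -
    have "\<C> S2 = {S2}" using circ(2) unfolding \<C>_def matroid_circuit_def by blast
    moreover have "rk K (f ` S2) = r - 2"
      unfolding K_def using card_f[of S2] SV card_S[OF S(2)] r by (subst rk_small) auto
    moreover have "rk ?M S2 = r - 3"
      using rk_in[OF Un_X_in_D[OF S(2)]] rk_X by (simp add: matroid_contract_def K_def)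
    ultimately show ?thesis using lift[of S2] SV r by simp
  qed
  moreover have "rk N ({S1, S2} \<union> {S2, S3}) + rk N ({S1, S2} \<inter> {S2, S3}) \<le> rk N {S1, S2} + rk N {S2, S3}"
    using circ N(2) by (intro N.rk_submodular) (auto simp: matroid_circuits_def)
  moreover have "rk N {S2} \<le> rk N ({S1, S2} \<inter> {S2, S3})"
    using circ N(2) by (intro N.rk_mono) (auto simp: matroid_circuits_def)
  moreover have "rk N {S1, S3} \<le> rk N ({S1, S2} \<union> {S2, S3})"
    using circ N(2) by (intro N.rk_mono) (auto simp: matroid_circuits_def)
  moreover have "rk N (\<C> (S1 \<union> S3)) \<le> rk N {S1, S3}"
  proof -
    have "card (S1 \<union> S3) - rk ?M (S1 \<union> S3) = 2" using rkM[of "S1 \<union> S3"] SV H(4) r by simp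
    then have "\<C> (S1 \<union> S3) \<subseteq> matroid_closure N {S1, S3}"
      using mod circ unfolding modular_pair_condition_def \<C>_def by blast
    moreover have g: "{S1, S3} \<subseteq> ground N" using circ N(2) by (auto simp: matroid_circuits_def)
    ultimately have "rk N ({S1, S3} \<union> \<C> (S1 \<union> S3)) = rk N {S1, S3}" by (intro N.rk_subset_closure)
    moreover have "rk N (\<C> (S1 \<union> S3)) \<le> rk N ({S1, S3} \<union> \<C> (S1 \<union> S3))"
      using g \<C>_ground by (intro N.rk_mono) auto
    ultimately show ?thesis by simp
  qed
  ultimately show False by simp
qed

text \<open>The circuit \<open>S \<union> X\<close> singles out a point in the span of
  \<open>S\<close> on the line spanned by \<open>X\<close>, with coordinates \<open>w x\<close> and
  \<open>w y\<close>. If \<open>S \<union> S'\<close> is a circuit, the points of \<open>S\<close>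
  and \<open>S'\<close> must coincide. So \<open>S1\<close> and \<open>S3\<close> have the same
  point, which makes \<open>S1 \<union> S3\<close> dependent, although it is an \<open>r\<close>-set
  outside \<open>\<D>\<close>.\<close>

lemma not_representable_over:
  assumes F: "field F" and S: "S1 \<in> \<S>" "S2 \<in> \<S>" "S3 \<in> \<S>"
    and H: "S1 \<union> S2 \<in> \<H>" "S2 \<union> S3 \<in> \<H>" "S1 \<union> S3 \<notin> \<H>" "card (S1 \<union> S3) = r"
  shows "\<not> representable_over F K"
proof
  assume "representable_over F K"
  then obtain n v where v: "\<And>e i. e \<in> V \<union> X \<Longrightarrow> i < n \<Longrightarrow> v e i \<in> carrier F"
    and ind: "\<And>S. S \<subseteq> V \<union> X \<Longrightarrow> matroid_indep K S \<longleftrightarrow> lin_indep_family F n v S"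
    unfolding representable_over_def K_def by auto
  interpret F: field F by (rule F)
  let ?dep = "dependency F n v (V \<union> X)"
  have car: "c e \<in> carrier F" if "?dep c" "e \<in> V \<union> X" for c e
    using that by (auto simp: dependency_def)
  have fin: "finite (V \<union> X)" using finite_V finite_X by simp
  have zero: "c e = \<zero>\<^bsub>F\<^esub>"
    if "?dep c" "S \<subseteq> V \<union> X" "matroid_indep K S" "\<And>e. e \<in> V \<union> X - S \<Longrightarrow> c e = \<zero>\<^bsub>F\<^esub>" "e \<in> V \<union> X" for c S e
  proof (cases "e \<in> S")
    case True
    have S: "dependency F n v S c"
      using that(1,4) by (subst F.dependency_restrict_iff[symmetric, OF fin that(2) v])
        (auto simp: dependency_def)
    have "lin_indep_family F n v S" using ind[OF that(2)] that(3) by blast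
    then show ?thesis by (rule lin_indep_family_dependency[OF _ S True])
  qed (use that in auto)
  \<comment> \<open>The support is all of \<open>D\<close>: a further zero would leave a nontrivial
    relation on a proper subset of a circuit.\<close>
  have ex: "\<exists>c. ?dep c \<and> (\<forall>e\<in>V \<union> X. c e = \<zero>\<^bsub>F\<^esub> \<longleftrightarrow> e \<notin> D)" if D: "D \<in> \<D>" for D
  proof -
    have DV: "D \<subseteq> V \<union> X" using D sub by auto
    have circ: "matroid_circuit K D" unfolding K_def by (rule circuit_D[OF D])
    then have "\<not> lin_indep_family F n v D" using ind[OF DV] by (simp add: matroid_circuit_def)
    then obtain c e where c: "dependency F n v D c" and e: "e \<in> D" "c e \<noteq> \<zero>\<^bsub>F\<^esub>"
      unfolding lin_indep_family_def dependency_def by auto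
    define c' where "c' e = (if e \<in> D then c e else \<zero>\<^bsub>F\<^esub>)" for e
    have "dependency F n v D c'"
    proof -
      have "(\<Oplus>\<^bsub>F\<^esub>e\<in>D. c' e \<otimes>\<^bsub>F\<^esub> v e i) = (\<Oplus>\<^bsub>F\<^esub>e\<in>D. c e \<otimes>\<^bsub>F\<^esub> v e i)" if "i < n" for i
        using c DV v that by (intro F.finsum_cong') (auto simp: c'_def dependency_def Pi_def)
      then show ?thesis using c by (auto simp: dependency_def c'_def)
    qed
    then have d: "?dep c'"
      using c by (subst F.dependency_restrict_iff[OF fin DV v]) (auto simp: dependency_def c'_def)
    have "c' x \<noteq> \<zero>\<^bsub>F\<^esub>" if x: "x \<in> D" for x
    proof
      assume x0: "c' x = \<zero>\<^bsub>F\<^esub>"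
      have "matroid_indep K (D - {x})" using circ x unfolding matroid_circuit_def by blast
      then have "c' e = \<zero>\<^bsub>F\<^esub>"
        using d DV e x0 by (intro zero[of c' "D - {x}" e]) (auto simp: c'_def)
      then show False using e by (simp add: c'_def)
    qed
    then show ?thesis using d by (auto simp: c'_def intro!: exI[of _ c'])
  qed
  obtain x y where xy: "X = {x, y}" "x \<noteq> y" using X(1) by (auto simp: card_2_iff)
  have nV: "x \<notin> V" "y \<notin> V" using xy X(2) by auto
  have SV: "S1 \<subseteq> V" "S2 \<subseteq> V" "S3 \<subseteq> V" using S \<S> by auto
  \<comment> \<open>Otherwise \<open>x\<close> is a combination of \<open>S \<union> S'\<close>, and exchanging it for some \<open>z \<in> S\<close> yields a
    dependent \<open>r\<close>-set which is not a circuit-hyperplane.\<close>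
  have minor: "w x \<otimes>\<^bsub>F\<^esub> w' y = w y \<otimes>\<^bsub>F\<^esub> w' x"
    if SS: "S \<in> \<S>" "S' \<in> \<S>" "S \<union> S' \<in> \<H>" and w: "?dep w" "?dep w'"
      "\<And>e. e \<in> V \<union> X \<Longrightarrow> w e = \<zero>\<^bsub>F\<^esub> \<longleftrightarrow> e \<notin> S \<union> X"
      "\<And>e. e \<in> V \<union> X \<Longrightarrow> w' e = \<zero>\<^bsub>F\<^esub> \<longleftrightarrow> e \<notin> S' \<union> X" for S S' w w'
  proof (rule ccontr)
    assume ne: "w x \<otimes>\<^bsub>F\<^esub> w' y \<noteq> w y \<otimes>\<^bsub>F\<^esub> w' x"
    have sub': "S \<subseteq> V" "S' \<subseteq> V" using SS \<S> by auto
    have xyc: "w x \<in> carrier F" "w y \<in> carrier F" "w' x \<in> carrier F" "w' y \<in> carrier F"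
      using w xy car by auto
    define c where "c e = w' y \<otimes>\<^bsub>F\<^esub> w e \<ominus>\<^bsub>F\<^esub> w y \<otimes>\<^bsub>F\<^esub> w' e" for e
    have c: "?dep c" unfolding c_def by (rule F.dependency_combination[OF fin v w(1,2) xyc(4,2)])
    have cx: "c x \<noteq> \<zero>\<^bsub>F\<^esub>"
      using ne xyc unfolding c_def by (metis F.m_closed F.m_comm F.r_right_minus_eq)
    have cy: "c y = \<zero>\<^bsub>F\<^esub>" using xyc unfolding c_def by (metis F.m_closed F.m_comm F.r_right_minus_eq)
    have c0: "c e = \<zero>\<^bsub>F\<^esub>" if "e \<in> V" "e \<notin> S \<union> S'" for e
    proof -
      have "w e = \<zero>\<^bsub>F\<^esub>" "w' e = \<zero>\<^bsub>F\<^esub>" using w(3,4)[of e] that nV xy by auto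
      then show ?thesis using xyc by (simp add: c_def F.minus_eq)
    qed
    obtain u where u: "?dep u" "\<And>e. e \<in> V \<union> X \<Longrightarrow> u e = \<zero>\<^bsub>F\<^esub> \<longleftrightarrow> e \<notin> S \<union> S'"
      using ex[of "S \<union> S'"] SS(3) by (auto simp: \<D>_def)
    have "S \<noteq> {}" using card_S[OF SS(1)] r by auto
    then obtain z where z: "z \<in> S" by blast
    then have zV: "z \<in> V" using sub' by auto
    have uz: "u z \<noteq> \<zero>\<^bsub>F\<^esub>" "u z \<in> carrier F" "c z \<in> carrier F" using u z zV c car by auto
    define c' where "c' e = u z \<otimes>\<^bsub>F\<^esub> c e \<ominus>\<^bsub>F\<^esub> c z \<otimes>\<^bsub>F\<^esub> u e" for e
    have c': "?dep c'" unfolding c'_def by (rule F.dependency_combination[OF fin v c u(1) uz(2,3)])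
    let ?I = "insert x (S \<union> S' - {z})"
    have cardI: "card ?I = r"
    proof -
      have "x \<notin> S \<union> S'" using sub' nV by auto
      then have "card ?I = card (S \<union> S' - {z}) + 1" using sub' finite_sub by simp
      also have "\<dots> = card (S \<union> S')" using z sub' finite_sub by (subst card_Suc_Diff1[symmetric, of _ z]) auto
      finally show ?thesis using card_H[OF SS(3)] by simp
    qed
    have "?I \<notin> \<D>"
    proof
      assume "?I \<in> \<D>"
      moreover have "S \<union> S' \<in> \<D>" "?I \<noteq> S \<union> S'" using SS(3) z nV sub' by (auto simp: \<D>_def)
      ultimately have "card (?I \<inter> (S \<union> S')) + 2 \<le> r" using sprd by (simp add: spread_def)
      moreover have "?I \<inter> (S \<union> S') = S \<union> S' - {z}" using sub' nV by auto
      moreover have "card (S \<union> S' - {z}) = r - 1"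
        using card_H[OF SS(3)] z by (simp add: card_Diff_singleton)
      ultimately show False using r by simp
    qed
    then have I: "matroid_indep K ?I"
      using sub' xy cardI unfolding K_def by (subst indep_paving) auto
    have c'0: "c' e = \<zero>\<^bsub>F\<^esub>" if "e \<in> V \<union> X - ?I" for e
    proof -
      consider "e = z" | "e = y" | "e \<in> V" "e \<notin> S \<union> S'" using \<open>e \<in> V \<union> X - ?I\<close> xy by auto
      then show ?thesis
      proof cases
        case 1 then show ?thesis using uz by (simp add: c'_def F.m_comm F.r_right_minus_eq)
      next
        case 2
        then have "u e = \<zero>\<^bsub>F\<^esub>" using u(2)[of y] xy nV sub' by auto
        then show ?thesis using uz cy 2 by (simp add: c'_def F.minus_eq)
      next
        case 3
        then have "u e = \<zero>\<^bsub>F\<^esub>" using u(2)[of e] by auto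
        then show ?thesis using uz c0[OF 3] by (simp add: c'_def F.minus_eq)
      qed
    qed
    have "?I \<subseteq> V \<union> X" "x \<in> V \<union> X" using sub' xy by auto
    then have "c' x = \<zero>\<^bsub>F\<^esub>" by (intro zero[OF c' _ I c'0])
    moreover have "c' x = u z \<otimes>\<^bsub>F\<^esub> c x"
    proof -
      have "u x = \<zero>\<^bsub>F\<^esub>" using u(2)[of x] xy nV sub' by auto
      moreover have "c x \<in> carrier F" using xy by (intro car[OF c]) simp
      ultimately show ?thesis using uz by (simp add: c'_def F.minus_eq)
    qed
    moreover have "c x \<in> carrier F" using xy by (intro car[OF c]) simp
    ultimately show False using F.integral[of "u z" "c x"] uz cx by simp
  qed
  obtain w1 where w1: "?dep w1" "\<And>e. e \<in> V \<union> X \<Longrightarrow> w1 e = \<zero>\<^bsub>F\<^esub> \<longleftrightarrow> e \<notin> S1 \<union> X"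
    using ex[OF Un_X_in_D[OF S(1)]] by blast
  obtain w2 where w2: "?dep w2" "\<And>e. e \<in> V \<union> X \<Longrightarrow> w2 e = \<zero>\<^bsub>F\<^esub> \<longleftrightarrow> e \<notin> S2 \<union> X"
    using ex[OF Un_X_in_D[OF S(2)]] by blast
  obtain w3 where w3: "?dep w3" "\<And>e. e \<in> V \<union> X \<Longrightarrow> w3 e = \<zero>\<^bsub>F\<^esub> \<longleftrightarrow> e \<notin> S3 \<union> X"
    using ex[OF Un_X_in_D[OF S(3)]] by blast
  have cl: "w1 x \<in> carrier F" "w1 y \<in> carrier F" "w2 x \<in> carrier F" "w2 y \<in> carrier F"
    "w3 x \<in> carrier F" "w3 y \<in> carrier F" using car w1 w2 w3 xy by auto
  have m12: "w1 x \<otimes>\<^bsub>F\<^esub> w2 y = w1 y \<otimes>\<^bsub>F\<^esub> w2 x" by (rule minor[OF S(1,2) H(1) w1(1) w2(1) w1(2) w2(2)])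
  have m23: "w2 x \<otimes>\<^bsub>F\<^esub> w3 y = w2 y \<otimes>\<^bsub>F\<^esub> w3 x" by (rule minor[OF S(2,3) H(2) w2(1) w3(1) w2(2) w3(2)])
  have nz: "w2 x \<noteq> \<zero>\<^bsub>F\<^esub>" "w3 x \<noteq> \<zero>\<^bsub>F\<^esub>" using w2(2)[of x] w3(2)[of x] xy by auto
  have "w2 x \<otimes>\<^bsub>F\<^esub> (w1 x \<otimes>\<^bsub>F\<^esub> w3 y) = w1 x \<otimes>\<^bsub>F\<^esub> (w2 x \<otimes>\<^bsub>F\<^esub> w3 y)" using cl by (simp add: F.m_lcomm)
  also have "\<dots> = (w1 x \<otimes>\<^bsub>F\<^esub> w2 y) \<otimes>\<^bsub>F\<^esub> w3 x" using cl by (simp add: m23 F.m_assoc)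
  also have "\<dots> = w2 x \<otimes>\<^bsub>F\<^esub> (w1 y \<otimes>\<^bsub>F\<^esub> w3 x)" using cl by (simp add: m12 F.m_assoc F.m_lcomm)
  finally have m13: "w1 x \<otimes>\<^bsub>F\<^esub> w3 y = w1 y \<otimes>\<^bsub>F\<^esub> w3 x"
    using F.m_lcancel[OF nz(1)] cl by simp
  \<comment> \<open>Proportionality on \<open>X\<close> cancels both \<open>x\<close> and
    \<open>y\<close>, so this relation lives on \<open>S1 \<union> S3\<close>; at a point of
    \<open>S1 - S3\<close> it is \<open>w3 x\<close> times \<open>w1 e\<close>, which is
    nonzero.\<close>
  define c where "c e = w3 x \<otimes>\<^bsub>F\<^esub> w1 e \<ominus>\<^bsub>F\<^esub> w1 x \<otimes>\<^bsub>F\<^esub> w3 e" for e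
  have c: "?dep c" unfolding c_def by (rule F.dependency_combination[OF fin v w1(1) w3(1) cl(5,1)])
  have "c x = \<zero>\<^bsub>F\<^esub>" using cl unfolding c_def by (metis F.m_closed F.m_comm F.r_right_minus_eq)
  moreover have "c y = \<zero>\<^bsub>F\<^esub>" using cl m13 unfolding c_def by (metis F.m_closed F.m_comm F.r_right_minus_eq)
  moreover have "c e = \<zero>\<^bsub>F\<^esub>" if "e \<in> V" "e \<notin> S1 \<union> S3" for e
  proof -
    have "w1 e = \<zero>\<^bsub>F\<^esub>" "w3 e = \<zero>\<^bsub>F\<^esub>" using w1(2)[of e] w3(2)[of e] that nV xy by auto
    then show ?thesis using cl by (simp add: c_def F.minus_eq)
  qed
  ultimately have c0: "c e = \<zero>\<^bsub>F\<^esub>" if "e \<in> V \<union> X - (S1 \<union> S3)" for e using that xy by auto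
  have "matroid_indep K (S1 \<union> S3)"
    using SV H(3,4) in_D_iff[of "S1 \<union> S3"] unfolding K_def by (subst indep_paving) auto
  then have c1: "c e = \<zero>\<^bsub>F\<^esub>" if "e \<in> V \<union> X" for e
    using SV by (intro zero[OF c _ _ c0 that]) auto
  have "\<not> S1 \<subseteq> S3"
  proof
    assume "S1 \<subseteq> S3"
    then have "card S3 = r" using H(4) by (simp add: Un_absorb1)
    then show False using card_S[OF S(3)] r by simp
  qed
  then obtain e where e: "e \<in> S1" "e \<notin> S3" by blast
  then have "w3 e = \<zero>\<^bsub>F\<^esub>" "w1 e \<noteq> \<zero>\<^bsub>F\<^esub>" "w1 e \<in> carrier F" "c e = \<zero>\<^bsub>F\<^esub>"
    using w1(2)[of e] w3(2)[of e] car[OF w1(1), of e] c1[of e] SV nV xy by auto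
  moreover from this have "c e = w3 x \<otimes>\<^bsub>F\<^esub> w1 e" using cl by (simp add: c_def F.minus_eq)
  ultimately show False using F.integral[of "w3 x" "w1 e"] nz cl by simp
qed

theorem counterexample:
  assumes viol: "\<And>f. bij_betw f V V \<Longrightarrow> \<exists>S1\<in>\<S>. \<exists>S2\<in>\<S>. \<exists>S3\<in>\<S>.
    f ` (S1 \<union> S2) \<in> \<H> \<and> f ` (S2 \<union> S3) \<in> \<H> \<and> f ` (S1 \<union> S3) \<notin> \<H> \<and> card (S1 \<union> S3) = r"
  shows "matroid K \<and> matroid_rank K = r \<and> sparse_paving K \<and> \<not> representable K \<and>
    X \<subseteq> ground K \<and> card X = 2 \<and>
    \<not> (\<exists>N :: 'a set rank_system.
        matroid N \<and> ground N = matroid_circuits (matroid_contract K X) \<and>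
        modular_pair_condition (matroid_contract K X) N \<and>
        matroid_isomorphic (matroid_lift (matroid_contract K X) N) (matroid_delete K X))"
proof -
  have "\<not> representable K"
    using viol[of "\<lambda>x. x"] not_representable_over unfolding representable_def
    by (auto simp: bij_betw_def)
  moreover have False
    if N: "matroid N" "ground N = matroid_circuits (matroid_contract K X)"
      "modular_pair_condition (matroid_contract K X) N"
      and iso: "matroid_isomorphic (matroid_lift (matroid_contract K X) N) (matroid_delete K X)" for N
  proof -
    have g: "ground (matroid_lift (matroid_contract K X) N) = V" "ground (matroid_delete K X) = V"
      using ground_contract X by (auto simp: matroid_lift_def matroid_delete_def K_def)
    obtain f where f: "bij_betw f V V"
      "\<And>Y. Y \<subseteq> V \<Longrightarrow> rk K (f ` Y) = rk (matroid_lift (matroid_contract K X) N) Y"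
      using iso unfolding matroid_isomorphic_def g by (auto simp: matroid_delete_def)
    show False using viol[OF f(1)] no_lift[OF N f(2,1)] by blast
  qed
  ultimately show ?thesis
    using matroid_paving rank_paving sparse_paving_paving X unfolding K_def by auto
qed

end

section \<open>Random stars\<close>

text \<open>Each such set arises from \<open>R\<close> by replacing one point \<open>y\<close> of
  \<open>R\<close> by a point \<open>x\<close> of \<open>E\<close>; \<open>R\<close> itself is the
  case \<open>x = y\<close>.\<close>

lemma card_near_sets:
  assumes E: "finite E" and R: "R \<subseteq> E" "card R = Suc k"
  shows "card {H. H \<subseteq> E \<and> card H = Suc k \<and> k \<le> card (H \<inter> R)} \<le> Suc k * card E"
proof -
  have "{H. H \<subseteq> E \<and> card H = Suc k \<and> k \<le> card (H \<inter> R)} \<subseteq> (\<lambda>(y, x). insert x (R - {y})) ` (R \<times> E)"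
  proof
    fix H assume "H \<in> {H. H \<subseteq> E \<and> card H = Suc k \<and> k \<le> card (H \<inter> R)}"
    then have H: "H \<subseteq> E" "card H = Suc k" "k \<le> card (H \<inter> R)" by auto
    have fin: "finite R" "finite H" using H(1) R(1) E finite_subset by auto
    have "card (R - H) = Suc k - card (H \<inter> R)"
      using fin R(2) by (metis Int_commute card_Diff_subset_Int finite_Int)
    then have "card (R - H) = 0 \<or> card (R - H) = 1" using H(3) by linarith
    then obtain y where y: "y \<in> R" "R - {y} \<subseteq> H"
    proof
      assume "card (R - H) = 0"
      then have "R \<subseteq> H" using fin by auto
      moreover obtain y where "y \<in> R" using R(2) by fastforce
      ultimately show thesis using that by blast
    next
      assume "card (R - H) = 1"
      then obtain y where "R - H = {y}" by (auto simp: card_1_singleton_iff)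
      then show thesis by (intro that[of y]) auto
    qed
    have "card (H - (R - {y})) = 1"
      using y fin H(2) R(2) by (simp add: card_Diff_subset card_Diff_singleton)
    then obtain x where "H - (R - {y}) = {x}" by (auto simp: card_1_singleton_iff)
    then have "H = insert x (R - {y})" "x \<in> E" using y H(1) by auto
    then show "H \<in> (\<lambda>(y, x). insert x (R - {y})) ` (R \<times> E)"
      using y(1) by (intro image_eqI[of _ _ "(y, x)"]) simp_all
  qed
  then have "card {H. H \<subseteq> E \<and> card H = Suc k \<and> k \<le> card (H \<inter> R)} \<le> card (R \<times> E)"
    using E finite_subset[OF R(1) E] by (intro surj_card_le) auto
  then show ?thesis using R(2) by (simp add: card_cartesian_product)
qed

text \<open>The marginal of one coordinate under the uniform distribution on tuples. The summand is
  written as a product over all coordinates so that distributivity applies.\<close>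

lemma sum_PiE_component:
  fixes f :: "'b \<Rightarrow> nat"
  assumes "finite I" "i \<in> I" "finite X"
  shows "(\<Sum>p\<in>I \<rightarrow>\<^sub>E X. f (p i)) = card X ^ (card I - 1) * sum f X"
proof -
  have "(\<Sum>p\<in>I \<rightarrow>\<^sub>E X. f (p i)) = (\<Sum>p\<in>I \<rightarrow>\<^sub>E X. \<Prod>k\<in>I. if k = i then f (p k) else 1)"
    using assms by (intro sum.cong refl) (simp add: prod.delta)
  also have "\<dots> = (\<Prod>k\<in>I. \<Sum>x\<in>X. if k = i then f x else 1)"
    by (rule prod_sum_PiE[symmetric]) (use assms in auto)
  also have "\<dots> = (\<Sum>x\<in>X. f x) * (\<Prod>k\<in>I - {i}. \<Sum>x\<in>X. if k = i then f x else 1)"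
    using assms by (subst prod.remove[of _ i]) auto
  also have "(\<Prod>k\<in>I - {i}. \<Sum>x\<in>X. if k = i then f x else 1) = (\<Prod>k\<in>I - {i}. card X)"
    by (intro prod.cong) auto
  also have "\<dots> = card X ^ (card I - 1)" using assms by simp
  finally show ?thesis by (simp add: mult.commute)
qed

type_synonym 'a gadget = "'a set \<times> (nat \<Rightarrow> 'a set)"

locale star_process =
  fixes E A B :: "'a set" and d :: nat
  assumes finite_E: "finite E" and E_eq: "E = A \<union> B" "A \<inter> B = {}"
begin

definition triples :: "'a set set" where "triples = {S. S \<subseteq> E \<and> card S = 3}"
text \<open>Petals are confined to \<open>B\<close> so that a marked point of \<open>B\<close> and
  two petals form a 5-set inside \<open>B\<close>, the third union of a path.\<close>

definition pairs :: "'a set set" where "pairs = {P. P \<subseteq> B \<and> card P = 2}"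
definition gadgets :: "'a gadget set" where "gadgets = triples \<times> ({..<d} \<rightarrow>\<^sub>E pairs)"

text \<open>
  Every new set meets \<open>A\<close>. The paths to be produced below have the form \<open>S1 \<union> S2\<close>, \<open>S2 \<union> S3\<close> with
  \<open>S1 \<union> S3 \<subseteq> B\<close>, so that no later set can complete them to a triangle.
\<close>

definition new :: "'a set set \<Rightarrow> 'a gadget \<Rightarrow> 'a set set" where
  "new \<H> g = {fst g \<union> snd g j | j. j < d \<and> fst g \<inter> A \<noteq> {} \<and> fst g \<inter> snd g j = {} \<and>
    (\<forall>H\<in>\<H>. card (H \<inter> (fst g \<union> snd g j)) \<le> 3) \<and> (\<forall>k<d. k \<noteq> j \<longrightarrow> snd g k \<inter> snd g j = {})}"

lemma newE:
  assumes "H \<in> new \<H> g"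
  obtains j where "H = fst g \<union> snd g j" "j < d" "fst g \<inter> A \<noteq> {}" "fst g \<inter> snd g j = {}"
    "\<forall>H\<in>\<H>. card (H \<inter> (fst g \<union> snd g j)) \<le> 3" "\<forall>k<d. k \<noteq> j \<longrightarrow> snd g k \<inter> snd g j = {}"
  using assms that unfolding new_def mem_Collect_eq by metis

lemma newI:
  assumes "j < d" "fst g \<inter> A \<noteq> {}" "fst g \<inter> snd g j = {}"
    "\<And>H. H \<in> \<H> \<Longrightarrow> card (H \<inter> (fst g \<union> snd g j)) \<le> 3"
    "\<And>k. k < d \<Longrightarrow> k \<noteq> j \<Longrightarrow> snd g k \<inter> snd g j = {}"
  shows "fst g \<union> snd g j \<in> new \<H> g"
  unfolding new_def mem_Collect_eq using assms by (intro exI[of _ j]) simp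

primrec build :: "'a gadget list \<Rightarrow> 'a set set" where
  "build [] = {}"
| "build (g # gs) = new (build gs) g \<union> build gs"

lemma finite_B: "finite B" using finite_E E_eq by simp

lemma finite_triples: "finite triples"
  unfolding triples_def by (rule finite_subset[of _ "Pow E"]) (use finite_E in auto)

lemma finite_pairs: "finite pairs"
  unfolding pairs_def by (rule finite_subset[of _ "Pow B"]) (use finite_B in auto)

lemma finite_gadgets: "finite gadgets"
  unfolding gadgets_def using finite_triples finite_pairs by (intro finite_cartesian_product finite_PiE) auto

lemma gadgetD:
  assumes "g \<in> gadgets"
  shows "fst g \<subseteq> E" "card (fst g) = 3" "finite (fst g)" "j < d \<Longrightarrow> snd g j \<subseteq> B" "j < d \<Longrightarrow> card (snd g j) = 2"
    "j < d \<Longrightarrow> finite (snd g j)"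
proof -
  show "fst g \<subseteq> E" "card (fst g) = 3" using assms by (auto simp: gadgets_def triples_def)
  then show "finite (fst g)" using finite_E finite_subset by auto
  assume "j < d"
  then have "snd g j \<in> pairs" using assms by (auto simp: gadgets_def)
  then show "snd g j \<subseteq> B" "card (snd g j) = 2" by (auto simp: pairs_def)
  then show "finite (snd g j)" using finite_B finite_subset by auto
qed

lemma new_D:
  assumes g: "g \<in> gadgets" and H: "H \<in> new \<H> g"
  shows "H \<subseteq> E" "card H = 5" "H \<inter> A \<noteq> {}"
proof -
  obtain j where j: "H = fst g \<union> snd g j" "j < d" "fst g \<inter> A \<noteq> {}" "fst g \<inter> snd g j = {}"
    using H by (rule newE)
  show "H \<subseteq> E" "H \<inter> A \<noteq> {}" using j gadgetD[OF g] E_eq by auto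
  show "card H = 5" using j gadgetD[OF g] by (simp add: card_Un_disjoint)
qed

lemma build_D:
  assumes "set gs \<subseteq> gadgets" "H \<in> build gs"
  shows "H \<subseteq> E" "card H = 5" "H \<inter> A \<noteq> {}"
proof -
  have "H \<subseteq> E \<and> card H = 5 \<and> H \<inter> A \<noteq> {}" using assms
  proof (induction gs)
    case (Cons g gs)
    then show ?case using new_D[of g H "build gs"] by auto
  qed simp
  then show "H \<subseteq> E" "card H = 5" "H \<inter> A \<noteq> {}" by auto
qed

text \<open>Since a kept petal avoids all other petals of its star, two sets of one star meet
  exactly in the center, which has three points. Sets of different stars are separated by the test
  against the earlier family.\<close>

lemma build_spread:
  assumes "set gs \<subseteq> gadgets" "H \<in> build gs" "H' \<in> build gs" "H \<noteq> H'"
  shows "card (H \<inter> H') \<le> 3"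
  using assms
proof (induction gs)
  case (Cons g gs)
  have g: "g \<in> gadgets" using Cons.prems(1) by simp
  have old: "card (H \<inter> H') \<le> 3" if "H \<in> build gs" "H' \<in> new (build gs) g" for H H'
    using that(1) newE[OF that(2)] by metis
  have "card (H \<inter> H') \<le> 3" if HH: "H \<in> new (build gs) g" "H' \<in> new (build gs) g"
  proof -
    obtain j where j: "H = fst g \<union> snd g j" "\<forall>i<d. i \<noteq> j \<longrightarrow> snd g i \<inter> snd g j = {}"
      using newE[OF HH(1)] by metis
    obtain k where k: "H' = fst g \<union> snd g k" "k < d"
      using newE[OF HH(2)] by metis
    have "j \<noteq> k" using j k Cons.prems(4) by auto
    then have "snd g k \<inter> snd g j = {}" using j k by auto
    then have "H \<inter> H' = fst g" using j k by auto
    then show ?thesis using gadgetD[OF g] by simp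
  qed
  then show ?case using Cons old[of H H'] old[of H' H] by (auto simp: Int_commute)
qed simp

end

text \<open>
  \<open>\<T>\<close> is a partial triple system. A center \<open>S \<in> \<C>\<close> meets \<open>A\<close> and has a marked point \<open>\<zeta> S\<close> in \<open>B\<close>;
  the pairs in \<open>good S\<close> extend \<open>\<zeta> S\<close> to further triples of \<open>\<T>\<close>. The system is killed once two good
  petals are attached to the same center.
\<close>

locale star_target = star_process E A B d for E A B :: "'a set" and d +
  fixes \<T> \<C> :: "'a set set" and \<zeta> :: "'a set \<Rightarrow> 'a" and good :: "'a set \<Rightarrow> 'a set set" and h M' :: nat
  assumes linear: "\<lbrakk>S \<in> \<T>; S' \<in> \<T>; x \<in> S \<inter> S'; y \<in> S \<inter> S'; x \<noteq> y\<rbrakk> \<Longrightarrow> S = S'"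
    and \<C>: "S \<in> \<C> \<Longrightarrow> S \<in> \<T> \<and> S \<subseteq> E \<and> card S = 3 \<and> S \<inter> A \<noteq> {} \<and> \<zeta> S \<in> S \<inter> B"
    and good: "\<lbrakk>S \<in> \<C>; P \<in> good S\<rbrakk> \<Longrightarrow>
      P \<subseteq> B \<and> card P = 2 \<and> insert (\<zeta> S) P \<in> \<T> \<and> S \<inter> P = {}"
    and card_\<C>: "card \<C> = 2 * M'" and card_good: "S \<in> \<C> \<Longrightarrow> card (good S) = 2 * h"
    and h_pos: "0 < h"
begin

definition killed :: "'a set set \<Rightarrow> bool" where
  "killed \<H> \<longleftrightarrow> (\<exists>S\<in>\<C>. \<exists>P\<in>good S. \<exists>P'\<in>good S. P \<noteq> P' \<and> S \<union> P \<in> \<H> \<and> S \<union> P' \<in> \<H>)"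

definition "Rel = Sigma \<C> good"

definition near :: "'a set \<Rightarrow> ('a set \<times> 'a set) set" where
  "near H = {q \<in> Rel. 4 \<le> card (H \<inter> (fst q \<union> snd q))}"

text \<open>A relevant 5-set that already belongs to \<open>\<H>\<close> counts as blocked too, so a
  later star is only credited with sets that it adds itself.\<close>

definition blocked :: "'a set set \<Rightarrow> ('a set \<times> 'a set) set" where
  "blocked \<H> = {q \<in> Rel. \<exists>H\<in>\<H>. 4 \<le> card (H \<inter> (fst q \<union> snd q))}"

text \<open>Petals that the greedy test would reject are charged as well. The cost thus depends on
  the gadget alone and not on the past, and the costs along a random list are independent.\<close>

definition cost :: "'a gadget \<Rightarrow> nat" where
  "cost g = (\<Sum>j<d. if fst g \<inter> snd g j = {} then card (near (fst g \<union> snd g j)) else 0)"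

lemma killed_mono: "killed \<H> \<Longrightarrow> \<H> \<subseteq> \<H>' \<Longrightarrow> killed \<H>'"
  unfolding killed_def by blast

lemma finite_\<C>: "finite \<C>"
proof (rule finite_subset)
  show "\<C> \<subseteq> Pow E" using \<C> by blast
qed (use finite_E in simp)

lemma finite_good: "S \<in> \<C> \<Longrightarrow> finite (good S)"
  using card_good[of S] h_pos by (intro card_ge_0_finite) simp

lemma finite_Rel: "finite Rel"
  unfolding Rel_def using finite_\<C> finite_good by auto

lemma finite_near: "finite (near H)"
  unfolding near_def using finite_Rel by simp

lemma card_Rel: "card Rel = 4 * M' * h"
  unfolding Rel_def using finite_\<C> finite_good card_good card_\<C> by (simp add: card_SigmaI)

lemma Rel_D:
  assumes "q \<in> Rel"
  shows "fst q \<union> snd q \<subseteq> E" "card (fst q \<union> snd q) = 5"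
proof -
  have q: "fst q \<in> \<C>" "snd q \<in> good (fst q)" using assms by (auto simp: Rel_def)
  show "fst q \<union> snd q \<subseteq> E" using \<C>[OF q(1)] good[OF q] E_eq by auto
  have "finite (fst q)" "finite (snd q)"
    using \<C>[OF q(1)] good[OF q] finite_E finite_B finite_subset by auto
  then show "card (fst q \<union> snd q) = 5"
    using \<C>[OF q(1)] good[OF q] by (simp add: card_Un_disjoint)
qed

lemma card_blocked_build:
  assumes "set gs \<subseteq> gadgets"
  shows "card (blocked (build gs)) \<le> sum_list (map cost gs)"
  using assms
proof (induction gs)
  case Nil then show ?case by (simp add: blocked_def)
next
  case (Cons g gs)
  define f where "f j = (if fst g \<inter> snd g j = {} then near (fst g \<union> snd g j) else {})" for j
  have "\<exists>j<d. H = fst g \<union> snd g j \<and> fst g \<inter> snd g j = {}" if "H \<in> new (build gs) g" for H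
    using newE[OF that] by metis
  then have "blocked (build (g # gs)) \<subseteq> (\<Union>j<d. f j) \<union> blocked (build gs)"
    unfolding blocked_def near_def f_def by fastforce
  moreover have fin: "finite (f j)" for j using finite_near by (simp add: f_def)
  ultimately have "card (blocked (build (g # gs))) \<le> card ((\<Union>j<d. f j) \<union> blocked (build gs))"
    using finite_Rel by (intro card_mono) (auto simp: blocked_def)
  also have "\<dots> \<le> card (\<Union>j<d. f j) + card (blocked (build gs))" by (rule card_Un_le)
  also have "card (\<Union>j<d. f j) \<le> (\<Sum>j<d. card (f j))" by (rule card_UN_le) simp
  also have "(\<Sum>j<d. card (f j)) = cost g" unfolding cost_def f_def by (intro sum.cong) auto
  finally show ?case using Cons by simp
qed

text \<open>
  A set meeting \<open>S \<union> P\<close> in four points contains two points of \<open>S\<close> and one of \<open>P\<close>, and these three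
  points determine \<open>S\<close> and \<open>P\<close>, whence the constant \<open>5 ^ 3\<close>.
\<close>

lemma card_near:
  assumes H: "finite H" "card H = 5"
  shows "card (near H) \<le> 125"
proof -
  define \<tau> where "\<tau> x y = (SOME S. S \<in> \<T> \<and> x \<in> S \<and> y \<in> S)" for x y
  have \<tau>: "\<tau> x y = S" if "S \<in> \<T>" "x \<in> S" "y \<in> S" "x \<noteq> y" for x y S
  proof -
    have "\<tau> x y \<in> \<T> \<and> x \<in> \<tau> x y \<and> y \<in> \<tau> x y"
      unfolding \<tau>_def by (rule someI[of _ S]) (use that in auto)
    then show ?thesis using linear[of "\<tau> x y" S x y] that by auto
  qed
  define F where "F = (\<lambda>(u, v, p). (\<tau> u v, \<tau> (\<zeta> (\<tau> u v)) p - {\<zeta> (\<tau> u v)}))"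
  have "near H \<subseteq> F ` (H \<times> H \<times> H)"
  proof
    fix q assume q: "q \<in> near H"
    then have R: "q \<in> Rel" and c: "4 \<le> card (H \<inter> (fst q \<union> snd q))" by (auto simp: near_def)
    obtain S P where SP: "q = (S, P)" "S \<in> \<C>" "P \<in> good S" using R by (auto simp: Rel_def)
    have fin: "finite S" "finite P"
      using \<C>[OF SP(2)] good[OF SP(2,3)] finite_E finite_B finite_subset by auto
    have "card (H \<inter> (S \<union> P)) = card (H \<inter> S) + card (H \<inter> P)"
      using good[OF SP(2,3)] fin by (subst card_Un_disjoint[symmetric]) (auto simp: Int_Un_distrib)
    moreover have "card (H \<inter> S) \<le> 3" "card (H \<inter> P) \<le> 2"
      using \<C>[OF SP(2)] good[OF SP(2,3)] fin card_mono[of S "H \<inter> S"] card_mono[of P "H \<inter> P"] by auto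
    ultimately have "2 \<le> card (H \<inter> S)" "1 \<le> card (H \<inter> P)" using c SP(1) by auto
    then have "\<not> card (H \<inter> S) \<le> Suc 0" "H \<inter> P \<noteq> {}" by auto
    then obtain u v p where uvp: "u \<in> H" "u \<in> S" "v \<in> H" "v \<in> S" "u \<noteq> v" "p \<in> H" "p \<in> P"
      using card_le_Suc0_iff_eq[of "H \<inter> S"] H(1) by auto
    have "\<tau> u v = S" using \<tau> \<C>[OF SP(2)] uvp by auto
    moreover have "\<zeta> S \<notin> P" using good[OF SP(2,3)] \<C>[OF SP(2)] by auto
    moreover from this have "\<tau> (\<zeta> S) p = insert (\<zeta> S) P"
      using \<tau>[of "insert (\<zeta> S) P" "\<zeta> S" p] good[OF SP(2,3)] uvp by auto
    ultimately have "q = F (u, v, p)" using SP by (simp add: F_def)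
    then show "q \<in> F ` (H \<times> H \<times> H)" using uvp by blast
  qed
  then have "card (near H) \<le> card (H \<times> H \<times> H)" using H by (intro surj_card_le) auto
  then show ?thesis using H by (simp add: card_cartesian_product)
qed

lemma cost_le:
  assumes "g \<in> gadgets" shows "cost g \<le> 125 * d"
proof -
  have "cost g \<le> (\<Sum>j<d. 125)" unfolding cost_def
  proof (rule sum_mono)
    fix j assume "j \<in> {..<d}"
    then show "(if fst g \<inter> snd g j = {} then card (near (fst g \<union> snd g j)) else 0) \<le> 125"
      using gadgetD[OF assms] card_near[of "fst g \<union> snd g j"] by (simp add: card_Un_disjoint)
  qed
  then show ?thesis by simp
qed

text \<open>Double counting: each of the \<open>4 * M' * h\<close> relevant pairs is near at most
  \<open>5 * card E\<close> five-sets, and a five-set splits into a triple and a pair in at most 10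
  ways.\<close>

lemma sum_card_near:
  "(\<Sum>S\<in>triples. \<Sum>P\<in>pairs. if S \<inter> P = {} then card (near (S \<union> P)) else 0) \<le> 200 * M' * h * card E"
proof -
  define Q where "Q = {(S, P) \<in> triples \<times> pairs. S \<inter> P = {}}"
  have finQ: "finite Q"
    unfolding Q_def using finite_triples finite_pairs by - (rule finite_subset[of _ "triples \<times> pairs"], auto)
  have Q: "finite S" "finite P" "S \<union> P \<subseteq> E" "card (S \<union> P) = 5" "card S = 3" "S \<inter> P = {}"
    if "(S, P) \<in> Q" for S P
  proof -
    have S: "S \<in> triples" and P: "P \<in> pairs" and dis: "S \<inter> P = {}" using that by (simp_all add: Q_def)
    have sub: "S \<subseteq> E" "P \<subseteq> E" using S P E_eq(1) unfolding triples_def pairs_def by blast+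
    show 1: "finite S" "finite P" "S \<union> P \<subseteq> E" "card S = 3" "S \<inter> P = {}"
      using S dis sub finite_subset[OF sub(1) finite_E] finite_subset[OF sub(2) finite_E]
      by (simp_all add: triples_def)
    have "card P = 2" using P by (simp add: pairs_def)
    then show "card (S \<union> P) = 5" using 1 by (simp add: card_Un_disjoint)
  qed
  have per: "card {x \<in> Q. q \<in> near (fst x \<union> snd x)} \<le> 50 * card E" if q: "q \<in> Rel" for q
  proof -
    let ?N = "{H. H \<subseteq> E \<and> card H = Suc 4 \<and> 4 \<le> card (H \<inter> (fst q \<union> snd q))}"
    let ?D = "SIGMA H:?N. {S. S \<subseteq> H \<and> card S = 3}"
    have finN: "finite ?N" using finite_E by - (rule finite_subset[of _ "Pow E"], auto)
    have finS: "finite {S. S \<subseteq> H \<and> card S = 3}" if "H \<in> ?N" for H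
      using that finite_E finite_subset by - (rule finite_subset[of _ "Pow H"], auto)
    have "card {x \<in> Q. q \<in> near (fst x \<union> snd x)} \<le> card ?D"
    proof (rule card_inj_on_le)
      show "inj_on (\<lambda>x. (fst x \<union> snd x, fst x)) {x \<in> Q. q \<in> near (fst x \<union> snd x)}"
      proof (rule inj_onI)
        fix x y assume xy: "x \<in> {x \<in> Q. q \<in> near (fst x \<union> snd x)}" "y \<in> {x \<in> Q. q \<in> near (fst x \<union> snd x)}"
          and eq: "(fst x \<union> snd x, fst x) = (fst y \<union> snd y, fst y)"
        have "fst x \<inter> snd x = {}" "fst y \<inter> snd y = {}"
          using Q(6)[of "fst x" "snd x"] Q(6)[of "fst y" "snd y"] xy by simp_all
        then have "snd x = snd y" using eq by blast
        then show "x = y" using eq by (simp add: prod_eq_iff)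
      qed
      show "(\<lambda>x. (fst x \<union> snd x, fst x)) ` {x \<in> Q. q \<in> near (fst x \<union> snd x)} \<subseteq> ?D"
      proof
        fix z assume "z \<in> (\<lambda>x. (fst x \<union> snd x, fst x)) ` {x \<in> Q. q \<in> near (fst x \<union> snd x)}"
        then obtain S P where SP: "(S, P) \<in> Q" "q \<in> near (S \<union> P)" "z = (S \<union> P, S)" by auto
        then show "z \<in> ?D" using Q(3,4,5)[OF SP(1)] by (simp add: near_def)
      qed
      show "finite ?D" by (rule finite_SigmaI[OF finN finS])
    qed
    also have "\<dots> = (\<Sum>H\<in>?N. card {S. S \<subseteq> H \<and> card S = 3})" 
      by (rule card_SigmaI[OF finN ballI[OF finS]])
    also have "\<dots> = (\<Sum>H\<in>?N. 5 choose 3)"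
    proof (intro sum.cong refl)
      fix H assume "H \<in> ?N"
      then show "card {S. S \<subseteq> H \<and> card S = 3} = 5 choose 3"
        using n_subsets[of H 3] finite_E finite_subset by auto
    qed
    also have "\<dots> = 10 * card ?N" by (simp add: numeral_eq_Suc)
    also have "card ?N \<le> Suc 4 * card E"
      by (rule card_near_sets[OF finite_E]) (use Rel_D[OF q] in auto)
    finally show ?thesis by simp
  qed
  have "(\<Sum>S\<in>triples. \<Sum>P\<in>pairs. if S \<inter> P = {} then card (near (S \<union> P)) else 0)
      = (\<Sum>(S, P)\<in>triples \<times> pairs. if S \<inter> P = {} then card (near (S \<union> P)) else 0)"
    by (rule sum.cartesian_product)
  also have "\<dots> = (\<Sum>x\<in>Q. card (near (fst x \<union> snd x)))"
    unfolding Q_def using finite_triples finite_pairs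
    by (intro sum.mono_neutral_cong_right) (auto split: prod.splits)
  also have "\<dots> = (\<Sum>x\<in>Q. \<Sum>q\<in>Rel. if q \<in> near (fst x \<union> snd x) then 1 else 0)"
  proof (intro sum.cong refl)
    fix x
    have "near (fst x \<union> snd x) = Rel \<inter> {q. q \<in> near (fst x \<union> snd x)}" by (auto simp: near_def)
    then show "card (near (fst x \<union> snd x)) = (\<Sum>q\<in>Rel. if q \<in> near (fst x \<union> snd x) then 1 else 0)"
      using finite_Rel by (simp add: sum.If_cases)
  qed
  also have "\<dots> = (\<Sum>q\<in>Rel. \<Sum>x\<in>Q. if q \<in> near (fst x \<union> snd x) then 1 else 0)" by (rule sum.swap)
  also have "\<dots> = (\<Sum>q\<in>Rel. card {x \<in> Q. q \<in> near (fst x \<union> snd x)})"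
    using finQ by (intro sum.cong refl) (simp add: sum.If_cases Int_def)
  also have "\<dots> \<le> (\<Sum>q\<in>Rel. 50 * card E)" by (intro sum_mono per)
  also have "\<dots> = 200 * M' * h * card E" by (simp add: card_Rel)
  finally show ?thesis .
qed

lemma sum_cost: "(\<Sum>g\<in>gadgets. cost g) \<le> d * card pairs ^ (d - 1) * (200 * M' * h * card E)"
proof -
  let ?f = "\<lambda>S P. if S \<inter> P = {} then card (near (S \<union> P)) else 0"
  have "(\<Sum>g\<in>gadgets. cost g) = (\<Sum>(S, p)\<in>triples \<times> ({..<d} \<rightarrow>\<^sub>E pairs). \<Sum>j<d. ?f S (p j))"
    unfolding gadgets_def cost_def by (simp add: split_def)
  also have "\<dots> = (\<Sum>S\<in>triples. \<Sum>p\<in>{..<d} \<rightarrow>\<^sub>E pairs. \<Sum>j<d. ?f S (p j))"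
    by (rule sum.cartesian_product[symmetric])
  also have "\<dots> = (\<Sum>S\<in>triples. \<Sum>j<d. \<Sum>p\<in>{..<d} \<rightarrow>\<^sub>E pairs. ?f S (p j))"
    by (intro sum.cong refl sum.swap)
  also have "\<dots> = (\<Sum>S\<in>triples. \<Sum>j<d. card pairs ^ (d - 1) * sum (?f S) pairs)"
  proof (intro sum.cong refl)
    fix S j assume "j \<in> {..<d}"
    then show "(\<Sum>p\<in>{..<d} \<rightarrow>\<^sub>E pairs. ?f S (p j)) = card pairs ^ (d - 1) * sum (?f S) pairs"
      using sum_PiE_component[of "{..<d}" j pairs "?f S"] finite_pairs by simp
  qed
  also have "\<dots> = d * card pairs ^ (d - 1) * (\<Sum>S\<in>triples. sum (?f S) pairs)"
    by (simp add: sum_distrib_left mult.assoc)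
  also have "\<dots> \<le> d * card pairs ^ (d - 1) * (200 * M' * h * card E)"
    by (intro mult_left_mono sum_card_near) simp
  finally show ?thesis .
qed

end

section \<open>Exponential moments and killing probabilities for random lists\<close>

lemma lists_length_Suc:
  "{xs. set xs \<subseteq> A \<and> length xs = Suc n} = (\<lambda>(x, xs). x # xs) ` (A \<times> {xs. set xs \<subseteq> A \<and> length xs = n})"
  by (auto simp: length_Suc_conv image_iff)

text \<open>Independence of the entries of a random list, in unnormalised form; applied to powers,
  it factorises the exponential moment of a total cost.\<close>

lemma sum_lists_length:
  fixes f :: "'a \<Rightarrow> real"
  shows "(\<Sum>xs | set xs \<subseteq> A \<and> length xs = n. \<Prod>x\<leftarrow>xs. f x) = (\<Sum>x\<in>A. f x) ^ n"
proof (induction n)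
  case 0
  have "{xs. set xs \<subseteq> A \<and> length xs = 0} = {[]}" by auto
  then show ?case by simp
next
  case (Suc n)
  have "inj_on (\<lambda>(x, xs). x # xs) (A \<times> {xs. set xs \<subseteq> A \<and> length xs = n})" by (auto simp: inj_on_def)
  then have "(\<Sum>xs | set xs \<subseteq> A \<and> length xs = Suc n. \<Prod>x\<leftarrow>xs. f x)
      = (\<Sum>(x, xs)\<in>A \<times> {xs. set xs \<subseteq> A \<and> length xs = n}. f x * (\<Prod>x\<leftarrow>xs. f x))"
    unfolding lists_length_Suc by (subst sum.reindex) (auto simp: split_def)
  also have "\<dots> = (\<Sum>x\<in>A. f x) * (\<Sum>xs | set xs \<subseteq> A \<and> length xs = n. \<Prod>x\<leftarrow>xs. f x)"
    by (subst sum.cartesian_product[symmetric]) (simp add: sum_product)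
  finally show ?case using Suc by simp
qed

lemma prod_list_power: "(\<Prod>x\<leftarrow>xs. a ^ f x) = a ^ sum_list (map f xs)" for a :: real
  by (induction xs) (simp_all add: power_add)

text \<open>As \<open>y / D\<close> is at most 1, its square is absorbed into the linear term. The
  linear bound turns an estimate of the mean cost into one of the exponential moment.\<close>

lemma power_one_plus_le:
  assumes "y \<le> D" "0 < D"
  shows "(1 + 1 / real D) ^ y \<le> 1 + 2 * real y / real D"
proof -
  have "(1 + 1 / real D) ^ y \<le> exp (1 / real D) ^ y"
    by (intro power_mono exp_ge_add_one_self) (use assms in auto)
  also have "\<dots> = exp (real y / real D)" by (simp add: exp_of_nat_mult[symmetric])
  also have "\<dots> \<le> 1 + real y / real D + (real y / real D)\<^sup>2"
    using assms by (intro exp_bound) auto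
  also have "(real y / real D)\<^sup>2 \<le> real y / real D"
    using assms power_decreasing[of 1 2 "real y / real D"] by simp
  finally show ?thesis by simp
qed

lemma card_off_diagonal:
  assumes X: "finite X"
  shows "card {(p, q). p \<in> X \<and> q \<in> X \<and> p \<noteq> q} = card X * (card X - 1)"
proof -
  have "{(p, q). p \<in> X \<and> q \<in> X \<and> p \<noteq> q} = X \<times> X - (\<lambda>p. (p, p)) ` X" by auto
  moreover have "card ((\<lambda>p. (p, p)) ` X) = card X" by (intro card_image) (auto simp: inj_on_def)
  moreover have "(\<lambda>p. (p, p)) ` X \<subseteq> X \<times> X" by auto
  ultimately show ?thesis using X by (simp add: card_Diff_subset card_cartesian_product algebra_simps)
qed

context star_target
begin

definition free :: "'a set set \<Rightarrow> 'a set \<Rightarrow> 'a set set" where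
  "free \<H> S = {P \<in> good S. (S, P) \<notin> blocked \<H>}"

text \<open>A common point together with the mark \<open>\<zeta> S\<close> would be shared by two
  triples of the partial triple system.\<close>

lemma petals_disjoint:
  assumes "S \<in> \<C>" "p \<in> good S" "q \<in> good S" "p \<noteq> q"
  shows "p \<inter> q = {}"
proof (rule ccontr)
  assume "p \<inter> q \<noteq> {}"
  then obtain x where x: "x \<in> p" "x \<in> q" by blast
  have z: "\<zeta> S \<notin> p" "\<zeta> S \<notin> q"
    using \<C>[OF assms(1)] good[OF assms(1,2)] good[OF assms(1,3)] by blast+
  then have "insert (\<zeta> S) p = insert (\<zeta> S) q"
    using good[OF assms(1,2)] good[OF assms(1,3)] x
    by (intro linear[of _ _ x "\<zeta> S"]) auto
  then show False using z assms(4) by (metis insert_ident)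
qed

text \<open>The center is the middle triple and the outer ones are the mark \<open>\<zeta> S\<close>
  with either petal. The mark lies in \<open>S\<close>, so joining an outer triple to
  \<open>S\<close> adds just the petal.\<close>

lemma killed_imp_path:
  assumes "killed \<H>"
  shows "\<exists>S1\<in>\<T>. \<exists>S2\<in>\<T>. \<exists>S3\<in>\<T>. S1 \<union> S2 \<in> \<H> \<and> S2 \<union> S3 \<in> \<H> \<and> S1 \<union> S3 \<subseteq> B \<and> card (S1 \<union> S3) = 5"
proof -
  obtain S P P' where S: "S \<in> \<C>" "P \<in> good S" "P' \<in> good S" "P \<noteq> P'" "S \<union> P \<in> \<H>" "S \<union> P' \<in> \<H>"
    using assms unfolding killed_def by blast
  note P = good[OF S(1,2)] and P' = good[OF S(1,3)] and z = \<C>[OF S(1)]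
  let ?z = "\<zeta> S"
  have eq: "insert ?z P \<union> S = S \<union> P" "S \<union> insert ?z P' = S \<union> P'"
    "insert ?z P \<union> insert ?z P' = insert ?z (P \<union> P')" using z by auto
  have "finite P" "finite P'" using P P' finite_B finite_subset by blast+
  moreover have "?z \<notin> P \<union> P'" using z P P' by blast
  ultimately have "card (insert ?z (P \<union> P')) = 5"
    using petals_disjoint[OF S(1-4)] P P' by (simp add: card_Un_disjoint)
  moreover have "insert ?z (P \<union> P') \<subseteq> B" using z P P' by blast
  ultimately have "insert ?z P \<union> S \<in> \<H> \<and> S \<union> insert ?z P' \<in> \<H> \<and>
      insert ?z P \<union> insert ?z P' \<subseteq> B \<and> card (insert ?z P \<union> insert ?z P') = 5"
    using S(5,6) unfolding eq by blast
  then show ?thesis using z P P' by blast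
qed

text \<open>A center with fewer than \<open>h\<close> free petals accounts for more than
  \<open>h\<close> blocked pairs, so at most \<open>M'\<close> of the \<open>2 * M'\<close> centers
  are poor. This is the purpose of the factors 2 in the locale.\<close>

lemma many_free:
  assumes "card (blocked \<H>) \<le> M' * h"
  shows "M' \<le> card {S \<in> \<C>. h \<le> card (free \<H> S)}"
proof -
  let ?poor = "{S \<in> \<C>. \<not> h \<le> card (free \<H> S)}"
  have blocked_eq: "blocked \<H> = (SIGMA S:\<C>. good S - free \<H> S)"
    unfolding free_def by (auto simp: blocked_def Rel_def)
  have c: "card (good S - free \<H> S) = 2 * h - card (free \<H> S)" if "S \<in> \<C>" for S
    using card_good[OF that] finite_good[OF that] by (subst card_Diff_subset) (auto simp: free_def)
  have "card ?poor * h = (\<Sum>S\<in>?poor. h)" by simp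
  also have "\<dots> \<le> (\<Sum>S\<in>?poor. card (good S - free \<H> S))" using c by (intro sum_mono) auto
  also have "\<dots> \<le> (\<Sum>S\<in>\<C>. card (good S - free \<H> S))" using finite_\<C> by (intro sum_mono2) auto
  also have "\<dots> = card (blocked \<H>)"
    unfolding blocked_eq using finite_\<C> finite_good by (subst card_SigmaI) auto
  finally have "card ?poor * h \<le> M' * h" using assms by (rule order_trans)
  then have "card ?poor \<le> M'" using h_pos mult_le_cancel2 by blast
  moreover have "card ?poor + card {S \<in> \<C>. h \<le> card (free \<H> S)} = card \<C>"
    using finite_\<C> by (subst card_Un_disjoint[symmetric]) (auto intro!: arg_cong[of _ _ card])
  ultimately show ?thesis using card_\<C> by simp
qed

text \<open>Subtracted are the pairs through one of the at most four points of
  \<open>p \<union> q\<close> and the at most \<open>2 * h\<close> good petals.\<close>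

lemma card_avoiding:
  assumes S: "S \<in> \<C>" and pq: "p \<in> free \<H> S" "q \<in> free \<H> S"
  shows "card pairs - 4 * card B - 2 * h \<le> card {P \<in> pairs. P \<inter> (p \<union> q) = {} \<and> P \<notin> free \<H> S}"
proof -
  let ?O = "{P \<in> pairs. P \<inter> (p \<union> q) = {} \<and> P \<notin> free \<H> S}"
  let ?X = "(\<lambda>(x, y). {x, y}) ` ((p \<union> q) \<times> B)"
  have g: "p \<subseteq> B" "q \<subseteq> B" "card p = 2" "card q = 2"
    using pq good[OF S] by (auto simp: free_def)
  then have fin: "finite p" "finite q" using finite_B finite_subset by auto
  have "P \<in> ?X" if P: "P \<in> pairs" "P \<inter> (p \<union> q) \<noteq> {}" for P
  proof -
    obtain a b where ab: "P = {a, b}" "P \<subseteq> B" using P(1) by (auto simp: pairs_def card_2_iff)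
    then consider "a \<in> p \<union> q" | "b \<in> p \<union> q" using P(2) by auto
    then show ?thesis
    proof cases
      case 1 then show ?thesis using ab by (intro image_eqI[of _ _ "(a, b)"]) auto
    next
      case 2 then show ?thesis using ab by (intro image_eqI[of _ _ "(b, a)"]) auto
    qed
  qed
  then have "pairs \<subseteq> ?O \<union> ?X \<union> free \<H> S" by blast
  moreover have fin': "finite ?O" "finite ?X" "finite (free \<H> S)"
    using finite_pairs fin finite_B finite_good[OF S] by (auto simp: free_def)
  ultimately have "card pairs \<le> card (?O \<union> ?X \<union> free \<H> S)" by (intro card_mono) auto
  also have "\<dots> \<le> card ?O + card ?X + card (free \<H> S)"
    by (meson card_Un_le add_le_mono le_refl order_trans)
  also have "card (free \<H> S) \<le> 2 * h"
    using card_mono[OF finite_good[OF S], of "free \<H> S"] card_good[OF S] by (auto simp: free_def)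
  also have "card ?X \<le> card ((p \<union> q) \<times> B)" using fin finite_B by (intro card_image_le) auto
  also have "\<dots> \<le> 4 * card B" using card_Un_le[of p q] g by (simp add: card_cartesian_product)
  finally show ?thesis by simp
qed

text \<open>
  Only gadgets with exactly two free good petals are counted, which makes the classes of gadgets
  indexed by the center, the two positions and the two petals disjoint.
\<close>

lemma card_killing:
  assumes "card (blocked \<H>) \<le> M' * h"
  shows "M' * (\<Sum>j<d. j) * (h * (h - 1)) * (card pairs - 4 * card B - 2 * h) ^ (d - 2)
    \<le> card {g \<in> gadgets. killed (new \<H> g \<union> \<H>)}"
proof -
  let ?o = "card pairs - 4 * card B - 2 * h"
  define rich where "rich = {S \<in> \<C>. h \<le> card (free \<H> S)}"
  define T where "T S = {(p, q). p \<in> free \<H> S \<and> q \<in> free \<H> S \<and> p \<noteq> q}" for S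
  \<comment> \<open>Positions are ordered by \<open>i < j\<close> while \<open>(p, q)\<close> is an
    ordered pair, so every placement of two petals at two positions is listed once.\<close>
  define I where "I = (SIGMA S:rich. (SIGMA j:{..<d}. {..<j}) \<times> T S)"
  define O' where "O' S p q = {P \<in> pairs. P \<inter> (p \<union> q) = {} \<and> P \<notin> free \<H> S}" for S p q
  define \<Phi> where "\<Phi> = (\<lambda>(S, (j, i), (p, q)). {S} \<times>
    (\<Pi>\<^sub>E k\<in>{..<d}. if k = i then {p} else if k = j then {q} else O' S p q))"
  have finF: "finite (free \<H> S)" if "S \<in> \<C>" for S using finite_good[OF that] by (simp add: free_def)
  have finT: "finite (T S)" if "S \<in> \<C>" for S
    by (rule finite_subset[of _ "free \<H> S \<times> free \<H> S"]) (use finF[OF that] in \<open>auto simp: T_def\<close>)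
  have finI: "finite I"
    unfolding I_def using finite_\<C> finT by (intro finite_SigmaI) (auto simp: rich_def)
  have fin\<Phi>: "finite (\<Phi> x)" for x
    unfolding \<Phi>_def O'_def using finite_pairs by (auto simp: split_def intro!: finite_PiE)
  have I_D: "S \<in> \<C>" "i < j" "j < d" "p \<in> free \<H> S" "q \<in> free \<H> S" "p \<noteq> q"
    if "(S, (j, i), (p, q)) \<in> I" for S i j p q
    using that by (auto simp: I_def rich_def T_def)
  have \<Phi>_D: "f i = p" "f j = q" "\<And>k. k < d \<Longrightarrow> k \<noteq> i \<Longrightarrow> k \<noteq> j \<Longrightarrow> f k \<in> O' S p q"
    if "(S', f) \<in> \<Phi> (S, (j, i), (p, q))" "i < j" "j < d" for S S' f i j p q
  proof -
    have "f \<in> (\<Pi>\<^sub>E k\<in>{..<d}. if k = i then {p} else if k = j then {q} else O' S p q)"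
      using that(1) by (simp add: \<Phi>_def)
    then have f: "f k \<in> (if k = i then {p} else if k = j then {q} else O' S p q)" if "k < d" for k
      using that by (intro PiE_mem[where T = "\<lambda>k. if k = i then {p} else if k = j then {q} else O' S p q"]) auto
    show "f i = p" "f j = q" using f[of i] f[of j] that(2,3) by auto
    show "f k \<in> O' S p q" if "k < d" "k \<noteq> i" "k \<noteq> j" for k using f[of k] that by simp
  qed
  have disj: "\<Phi> x \<inter> \<Phi> y = {}" if xy: "x \<in> I" "y \<in> I" "x \<noteq> y" for x y
  proof (rule ccontr)
    assume "\<Phi> x \<inter> \<Phi> y \<noteq> {}"
    then obtain S0 f where Sf: "(S0, f) \<in> \<Phi> x" "(S0, f) \<in> \<Phi> y" by fast
    obtain S j i p q where x: "x = (S, (j, i), (p, q))" by (metis prod.exhaust)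
    obtain S' j' i' p' q' where y: "y = (S', (j', i'), (p', q'))" by (metis prod.exhaust)
    have "S = S0" "S' = S0" using Sf x y by (auto simp: \<Phi>_def)
    then have SS: "S' = S" by simp
    note xI = I_D[OF xy(1)[unfolded x]] and yI = I_D[OF xy(2)[unfolded y]]
    note fx = \<Phi>_D[OF Sf(1)[unfolded x] xI(2,3)] and fy = \<Phi>_D[OF Sf(2)[unfolded y] yI(2,3)]
    \<comment> \<open>The entries of \<open>f\<close> at \<open>i\<close> and \<open>j\<close> are
      free petals and no other entry is, so \<open>f\<close> determines the two positions and hence
      the petals.\<close>
    have "k = i' \<or> k = j'" if "k = i \<or> k = j" for k
    proof (rule ccontr)
      assume "\<not> (k = i' \<or> k = j')"
      then have "f k \<in> O' S p' q'" using fy(3)[of k] that xI SS by auto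
      moreover have "f k \<in> free \<H> S" using that fx xI by auto
      ultimately show False by (simp add: O'_def)
    qed
    then have "i = i'" "j = j'" using xI(2) yI(2) by (metis less_irrefl less_trans)+
    then show False using fx fy SS x y xy(3) by simp
  qed
  have card\<Phi>: "?o ^ (d - 2) \<le> card (\<Phi> x)" if x: "x \<in> I" for x
  proof -
    obtain S j i p q where xeq: "x = (S, (j, i), (p, q))" by (metis prod.exhaust)
    note xI = I_D[OF x[unfolded xeq]]
    have "card (\<Phi> x) = (\<Prod>k<d. card (if k = i then {p} else if k = j then {q} else O' S p q))"
      unfolding xeq \<Phi>_def by (simp add: card_cartesian_product card_PiE)
    also have "\<dots> = (\<Prod>k\<in>{..<d} - {i, j}. card (O' S p q))"
      using xI by (intro prod.mono_neutral_cong_right) auto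
    also have "\<dots> = card (O' S p q) ^ (d - 2)"
      using xI by (simp add: card_Diff_subset numeral_2_eq_2)
    finally show ?thesis
      using card_avoiding[OF xI(1,4,5)] unfolding O'_def by (simp add: power_mono)
  qed
  have sub: "\<Phi> x \<subseteq> {g \<in> gadgets. killed (new \<H> g \<union> \<H>)}" if x: "x \<in> I" for x
  proof
    fix g assume g: "g \<in> \<Phi> x"
    obtain S j i p q where xeq: "x = (S, (j, i), (p, q))" by (metis prod.exhaust)
    note xI = I_D[OF x[unfolded xeq]]
    obtain f where gf: "g = (S, f)" using g by (auto simp: xeq \<Phi>_def)
    note f = \<Phi>_D[OF g[unfolded gf xeq] xI(2,3)]
    have pq: "p \<in> good S" "q \<in> good S" using xI by (auto simp: free_def)
    have "f k \<in> pairs" if "k < d" for k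
    proof (cases "k = i \<or> k = j")
      case True then show ?thesis using f pq good[OF xI(1)] by (auto simp: pairs_def)
    next
      case False then show ?thesis using f(3)[OF that] by (auto simp: O'_def)
    qed
    moreover have "f \<in> extensional {..<d}" using g by (auto simp: xeq gf \<Phi>_def PiE_def)
    ultimately have "g \<in> gadgets"
      using \<C>[OF xI(1)] by (auto simp: gf gadgets_def triples_def PiE_def)
    \<comment> \<open>Being unblocked passes the test against \<open>\<H>\<close>; the other entries
      avoid \<open>p \<union> q\<close>, so both petals are kept.\<close>
    moreover have "S \<union> f k \<in> new \<H> g" if k: "k = i \<or> k = j" for k
    proof -
      have fk: "f k \<in> free \<H> S" using k f xI by auto
      then have fk': "f k \<in> good S" by (simp add: free_def)
      have "k < d" using k xI by auto
      moreover have "card (H \<inter> (S \<union> f k)) \<le> 3" if "H \<in> \<H>" for H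
        using fk that xI(1) by (force simp: free_def blocked_def Rel_def)
      moreover have "f l \<inter> f k = {}" if "l < d" "l \<noteq> k" for l
      proof (cases "l = i \<or> l = j")
        case True
        then have "f l \<in> good S" "f l \<noteq> f k" using k f pq that xI(6) by auto
        then show ?thesis using petals_disjoint[OF xI(1) _ fk'] by blast
      next
        case False
        then have "f l \<inter> (p \<union> q) = {}" using f(3)[OF that(1)] by (simp add: O'_def)
        then show ?thesis using k f by auto
      qed
      ultimately show ?thesis
        using newI[of k g \<H>] \<C>[OF xI(1)] good[OF xI(1) fk'] by (simp add: gf)
    qed
    then have "S \<union> p \<in> new \<H> g" "S \<union> q \<in> new \<H> g" using f(1,2) by blast+
    then have "killed (new \<H> g \<union> \<H>)" unfolding killed_def using xI pq by blast
    ultimately show "g \<in> {g \<in> gadgets. killed (new \<H> g \<union> \<H>)}" by simp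
  qed
  have cardI: "M' * (\<Sum>j<d. j) * (h * (h - 1)) \<le> card I"
  proof -
    have "card I = (\<Sum>S\<in>rich. card ((SIGMA j:{..<d}. {..<j}) \<times> T S))"
      unfolding I_def using finite_\<C> finT by (intro card_SigmaI) (auto simp: rich_def)
    also have "\<dots> = (\<Sum>S\<in>rich. (\<Sum>j<d. j) * (card (free \<H> S) * (card (free \<H> S) - 1)))"
      using finF by (intro sum.cong refl)
        (simp add: card_cartesian_product T_def card_off_diagonal rich_def)
    also have "\<dots> \<ge> (\<Sum>S\<in>rich. (\<Sum>j<d. j) * (h * (h - 1)))"
      by (intro sum_mono mult_le_mono) (auto simp: rich_def)
    also have "(\<Sum>S\<in>rich. (\<Sum>j<d. j) * (h * (h - 1))) = card rich * ((\<Sum>j<d. j) * (h * (h - 1)))"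
      by simp
    finally have "card rich * ((\<Sum>j<d. j) * (h * (h - 1))) \<le> card I" by simp
    moreover have "M' \<le> card rich" unfolding rich_def by (rule many_free[OF assms])
    ultimately show ?thesis by (metis mult.assoc mult_le_mono1 order_trans)
  qed
  have "M' * (\<Sum>j<d. j) * (h * (h - 1)) * ?o ^ (d - 2) \<le> card I * ?o ^ (d - 2)"
    by (rule mult_le_mono1[OF cardI])
  also have "\<dots> = (\<Sum>x\<in>I. ?o ^ (d - 2))" by simp
  also have "\<dots> \<le> (\<Sum>x\<in>I. card (\<Phi> x))" by (intro sum_mono card\<Phi>)
  also have "\<dots> = card (\<Union>x\<in>I. \<Phi> x)"
    using finI fin\<Phi> disj by (intro card_UN_disjoint[symmetric]) auto
  also have "\<dots> \<le> card {g \<in> gadgets. killed (new \<H> g \<union> \<H>)}"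
    by (rule card_mono[OF _ UN_least[OF sub]]) (use finite_gadgets in simp)
  finally show ?thesis .
qed

text \<open>Being killed and exceeding the budget both persist when a list is extended, so the tail
  of a surviving list survives. Its cost bounds the number of blocked pairs by
  \<open>M' * h\<close>, whence at least \<open>K\<close> choices of the next gadget kill, whatever
  the past.\<close>

lemma card_unkilled:
  assumes K: "K \<le> M' * (\<Sum>j<d. j) * (h * (h - 1)) * (card pairs - 4 * card B - 2 * h) ^ (d - 2)"
  shows "card {gs. set gs \<subseteq> gadgets \<and> length gs = t \<and> \<not> killed (build gs) \<and> sum_list (map cost gs) \<le> M' * h}
    \<le> (card gadgets - K) ^ t"
proof (induction t)
  case 0
  have "{gs. set gs \<subseteq> gadgets \<and> length gs = 0 \<and> \<not> killed (build gs) \<and> sum_list (map cost gs) \<le> M' * h} \<subseteq> {[]}"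
    by auto
  from card_mono[OF _ this] show ?case by simp
next
  case (Suc t)
  let ?U = "\<lambda>t. {gs. set gs \<subseteq> gadgets \<and> length gs = t \<and> \<not> killed (build gs) \<and> sum_list (map cost gs) \<le> M' * h}"
  let ?N = "\<lambda>gs. {g \<in> gadgets. \<not> killed (build (g # gs))}"
  have finU: "finite (?U t)"
    by (rule finite_subset[OF _ finite_lists_length_eq[OF finite_gadgets, of t]]) auto
  have finN: "finite (?N gs)" for gs using finite_gadgets by simp
  have "?U (Suc t) \<subseteq> (\<lambda>(gs, g). g # gs) ` (SIGMA gs:?U t. ?N gs)"
  proof
    fix xs assume xs: "xs \<in> ?U (Suc t)"
    then obtain g gs where eq: "xs = g # gs" "length gs = t" by (auto simp: length_Suc_conv)
    have "\<not> killed (build gs)" using xs killed_mono[of "build gs" "build xs"] eq by auto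
    then have "gs \<in> ?U t" "g \<in> ?N gs" using xs eq by auto
    then show "xs \<in> (\<lambda>(gs, g). g # gs) ` (SIGMA gs:?U t. ?N gs)"
      using eq by (intro image_eqI[of _ _ "(gs, g)"]) auto
  qed
  then have "card (?U (Suc t)) \<le> card (SIGMA gs:?U t. ?N gs)"
    by (intro surj_card_le finite_SigmaI finU finN)
  also have "\<dots> = (\<Sum>gs\<in>?U t. card (?N gs))"
    by (rule card_SigmaI[OF finU]) (use finN in blast)
  also have "\<dots> \<le> (\<Sum>gs\<in>?U t. card gadgets - K)"
  proof (rule sum_mono)
    fix gs assume gs: "gs \<in> ?U t"
    have "card (blocked (build gs)) \<le> M' * h" using gs card_blocked_build[of gs] by simp
    then have "K \<le> card {g \<in> gadgets. killed (build (g # gs))}"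
      using K card_killing[of "build gs"] by simp
    moreover have "card (?N gs) + card {g \<in> gadgets. killed (build (g # gs))} = card gadgets"
      using finite_gadgets by (subst card_Un_disjoint[symmetric]) (auto intro!: arg_cong[of _ _ card])
    ultimately show "card (?N gs) \<le> card gadgets - K" by simp
  qed
  also have "\<dots> = card (?U t) * (card gadgets - K)" by simp
  also have "\<dots> \<le> (card gadgets - K) ^ t * (card gadgets - K)" by (rule mult_le_mono1[OF Suc])
  finally show ?case by (simp add: mult.commute)
qed

text \<open>Markov's inequality for the exponential moment.\<close>

lemma card_costly:
  fixes x :: real
  assumes "1 \<le> x"
  shows "x ^ L * card {gs. set gs \<subseteq> gadgets \<and> length gs = t \<and> L < sum_list (map cost gs)}
    \<le> (\<Sum>g\<in>gadgets. x ^ cost g) ^ t"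
proof -
  let ?W = "{gs. set gs \<subseteq> gadgets \<and> length gs = t \<and> L < sum_list (map cost gs)}"
  have fin: "finite {gs. set gs \<subseteq> gadgets \<and> length gs = t}"
    by (rule finite_lists_length_eq[OF finite_gadgets])
  have "x ^ L * card ?W = (\<Sum>gs\<in>?W. x ^ L)" by simp
  also have "\<dots> \<le> (\<Sum>gs\<in>?W. x ^ sum_list (map cost gs))"
    using assms by (intro sum_mono power_increasing) auto
  also have "\<dots> \<le> (\<Sum>gs | set gs \<subseteq> gadgets \<and> length gs = t. x ^ sum_list (map cost gs))"
    using assms by (intro sum_mono2[OF fin]) auto
  also have "\<dots> = (\<Sum>g\<in>gadgets. x ^ cost g) ^ t"
    using sum_lists_length[of "\<lambda>g. x ^ cost g" gadgets t] by (simp add: prod_list_power)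
  finally show ?thesis .
qed

text \<open>The base is matched to the largest possible cost \<open>125 * d\<close>, so that the
  linear bound on the power applies to every gadget.\<close>

lemma sum_power_cost:
  assumes d: "0 < d"
  shows "(\<Sum>g\<in>gadgets. (1 + 1 / real (125 * d)) ^ cost g)
    \<le> card gadgets + 2 / real (125 * d) * (d * card pairs ^ (d - 1) * (200 * M' * h * card E))"
proof -
  have "(\<Sum>g\<in>gadgets. (1 + 1 / real (125 * d)) ^ cost g) \<le> (\<Sum>g\<in>gadgets. 1 + 2 * real (cost g) / real (125 * d))"
    using cost_le d by (intro sum_mono power_one_plus_le) auto
  also have "\<dots> = card gadgets + 2 / real (125 * d) * real (\<Sum>g\<in>gadgets. cost g)"
    by (simp add: sum.distrib sum_distrib_left)
  also have "real (\<Sum>g\<in>gadgets. cost g) \<le> real (d * card pairs ^ (d - 1) * (200 * M' * h * card E))"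
    using sum_cost by (rule of_nat_mono)
  finally show ?thesis by (simp add: mult_left_mono divide_right_mono)
qed

end

section \<open>Numerical estimates for the failure probability\<close>

lemma binomial_two_real: "real (n choose 2) = real n * (real n - 1) / 2"
proof (cases n)
  case (Suc m)
  have "2 * (n choose 2) = n * ((n - 1) choose 1)" using times_binomial_minus1_eq[of 2 n] by simp
  then have "2 * real (n choose 2) = real n * real (n - 1)"
    by (metis choose_one of_nat_mult of_nat_numeral)
  then show ?thesis using Suc by simp
qed simp

lemma binomial_three_real: "real (n choose 3) = real n * (real n - 1) * (real n - 2) / 6"
proof (cases n)
  case (Suc m)
  have "3 * (n choose 3) = n * ((n - 1) choose 2)" using times_binomial_minus1_eq[of 3 n] by simp
  then have "3 * real (n choose 3) = real n * real ((n - 1) choose 2)"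
    by (metis of_nat_mult of_nat_numeral)
  then show ?thesis using Suc binomial_two_real[of m] by (simp add: field_simps)
qed simp

lemma sum_lessThan_real: "real (\<Sum>j<d. j) = real d * (real d - 1) / 2"
  by (induction d) (auto simp: field_simps)

context star_target
begin

text \<open>A list fails either within the cost budget \<open>M' * h\<close>, which here is
  \<open>128 * d ^ 3\<close>, or by exceeding it. Within the budget each star kills with probability
  at least \<open>1 / (4 * 10 ^ 8 * d)\<close>, and \<open>4 * 10 ^ 8 / 128 = 3125000\<close>.
  Exceeding it has the far smaller probability \<open>exp (- 9 / 50 * d ^ 2)\<close>.\<close>

lemma card_bad_lists:
  assumes cE: "card E = 48 * d" and cB: "card B = 32 * d" and h: "h = 2 * d" and M: "M' = 64 * d\<^sup>2"
    and d2: "2 \<le> d"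
  shows "real (card {gs. set gs \<subseteq> gadgets \<and> length gs = 128 * d ^ 3 \<and> \<not> killed (build gs)})
    \<le> 2 * exp (- (real d)\<^sup>2 / 3125000) * real (card gadgets) ^ (128 * d ^ 3)"
proof -
  define N where "N = card pairs"
  define C where "C = card triples"
  define \<Omega> where "\<Omega> = card gadgets"
  define T where "T = 128 * d ^ 3"
  define K where "K = M' * (\<Sum>j<d. j) * (h * (h - 1)) * (N - 4 * card B - 2 * h) ^ (d - 2)"
  let ?d = "real d"
  have d': "2 \<le> ?d" using d2 by simp
  have "N = (32 * d) choose 2" unfolding N_def pairs_def using n_subsets[OF finite_B, of 2] cB by simp
  then have Nr: "real N = 16 * ?d * (32 * ?d - 1)" using binomial_two_real[of "32 * d"] by simp
  have "C = (48 * d) choose 3" unfolding C_def triples_def using n_subsets[OF finite_E, of 3] cE by simp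
  then have Cr: "real C = 8 * ?d * (48 * ?d - 1) * (48 * ?d - 2)"
    using binomial_three_real[of "48 * d"] by simp
  have N_le: "real N \<le> 512 * ?d\<^sup>2" and N_ge: "496 * ?d\<^sup>2 \<le> real N"
  proof -
    have "?d \<le> ?d\<^sup>2" using d' by (simp add: power2_eq_square)
    then show "real N \<le> 512 * ?d\<^sup>2" "496 * ?d\<^sup>2 \<le> real N"
      unfolding Nr by (simp_all add: power2_eq_square algebra_simps)
  qed
  have C_le: "real C \<le> 18432 * ?d ^ 3" and C_ge: "17296 * ?d ^ 3 \<le> real C"
  proof -
    have "real C \<le> 8 * ?d * (48 * ?d) * (48 * ?d)"
      unfolding Cr using d' by (intro mult_mono) auto
    then show "real C \<le> 18432 * ?d ^ 3" by (simp add: power3_eq_cube)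
    have "8 * ?d * (47 * ?d) * (46 * ?d) \<le> real C"
      unfolding Cr using d' by (intro mult_mono) auto
    then show "17296 * ?d ^ 3 \<le> real C" by (simp add: power3_eq_cube)
  qed
  have N_pos: "0 < real N" using N_ge d' by (smt (verit) zero_less_power)
  have \<Omega>r: "real \<Omega> = real C * real N ^ d"
    unfolding \<Omega>_def gadgets_def C_def N_def by (simp add: card_cartesian_product card_PiE)
  have \<Omega>_split: "real \<Omega> = real C * real N ^ 2 * real N ^ (d - 2)"
  proof -
    have "real N ^ d = real N ^ (2 + (d - 2))" by (simp only: le_add_diff_inverse[OF d2])
    then show ?thesis unfolding \<Omega>r by (simp only: power_add mult.assoc)
  qed

  \<comment> \<open>There are of order \<open>d ^ 6\<close> choices of center, positions and petals,
    against at most \<open>18432 * 512 ^ 2 * d ^ 7\<close> possibilities; the constant rounds up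
    \<open>18432 * 512 ^ 2 / 16\<close>.\<close>
  have K_ge: "real \<Omega> / (4 * 10 ^ 8 * ?d) \<le> real K"
  proof -
    have le: "132 * ?d\<^sup>2 \<le> real N / 2" using N_ge by simp
    have dd: "132 * ?d \<le> 132 * ?d\<^sup>2" using d' by (simp add: power2_eq_square)
    have sub: "real (N - 4 * card B - 2 * h) = real N - 132 * ?d"
    proof -
      have "real (132 * d) \<le> real N" using le dd N_pos by (simp only: of_nat_mult of_nat_numeral)
      then have "132 * d \<le> N" by (simp only: of_nat_le_iff)
      then show ?thesis unfolding cB h by (simp add: of_nat_diff)
    qed
    \<comment> \<open>The \<open>132 * d\<close> pairs, from \<open>4 * card B + 2 * h\<close>, are
      a fraction of order \<open>1 / d\<close> of all pairs, so \<open>d - 2\<close> petals avoid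
      them with probability at least one half.\<close>
    have "real N ^ (d - 2) / 2 \<le> (real N - 132 * ?d) ^ (d - 2)"
    proof -
      have "1 / 2 \<le> 1 + real (d - 2) * (- (132 * ?d / real N))"
      proof -
        have "real (d - 2) * (132 * ?d) \<le> ?d * (132 * ?d)" by (intro mult_right_mono) auto
        then have "real (d - 2) * (132 * ?d) \<le> real N / 2" using le by (simp add: power2_eq_square)
        then show ?thesis using N_pos by (simp add: field_simps)
      qed
      also have "\<dots> \<le> (1 + - (132 * ?d / real N)) ^ (d - 2)"
      proof (rule Bernoulli_inequality)
        have "132 * ?d \<le> real N" using le dd N_pos by linarith
        then show "- 1 \<le> - (132 * ?d / real N)" using N_pos by simp
      qed
      finally have "real N ^ (d - 2) * (1 / 2) \<le> real N ^ (d - 2) * (1 + - (132 * ?d / real N)) ^ (d - 2)"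
        using N_pos by (intro mult_left_mono) auto
      also have "\<dots> = (real N - 132 * ?d) ^ (d - 2)"
      proof -
        have "real N * (1 + - (132 * ?d / real N)) = real N - 132 * ?d" using N_pos by (simp add: field_simps)
        then show ?thesis by (simp only: power_mult_distrib[symmetric])
      qed
      finally show ?thesis by simp
    qed
    moreover have "?d\<^sup>2 / 4 \<le> real (\<Sum>j<d. j)"
      unfolding sum_lessThan_real using d' by (simp add: power2_eq_square field_simps)
    moreover have "2 * ?d\<^sup>2 \<le> real (h * (h - 1))"
    proof -
      have "real (h * (h - 1)) = 2 * ?d * (2 * ?d - 1)"
        unfolding h using d2 by (simp only: of_nat_mult) (simp add: of_nat_diff)
      moreover have "2 * ?d * ?d \<le> 2 * ?d * (2 * ?d - 1)" using d' by (intro mult_left_mono) auto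
      ultimately show ?thesis by (simp add: power2_eq_square)
    qed
    ultimately have "(64 * ?d\<^sup>2) * (?d\<^sup>2 / 4) * (2 * ?d\<^sup>2) * (real N ^ (d - 2) / 2)
        \<le> real M' * real (\<Sum>j<d. j) * real (h * (h - 1)) * (real N - 132 * ?d) ^ (d - 2)"
      unfolding M using N_pos by (intro mult_mono) (auto intro!: mult_nonneg_nonneg sum_nonneg)
    also have "\<dots> = real K" unfolding K_def sub[symmetric] by simp
    finally have lowK: "16 * ?d ^ 6 * real N ^ (d - 2) \<le> real K" by (simp add: eval_nat_numeral)
    have "real \<Omega> \<le> (4 * 10 ^ 8 * ?d) * (16 * ?d ^ 6 * real N ^ (d - 2))"
    proof -
      have "real C * real N ^ 2 \<le> (18432 * ?d ^ 3) * (512 * ?d\<^sup>2) ^ 2"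
        using C_le N_le N_pos by (intro mult_mono power_mono) auto
      also have "\<dots> = 4831838208 * ?d ^ 7" by (simp add: eval_nat_numeral)
      also have "\<dots> \<le> 6400000000 * ?d ^ 7" by simp
      also have "\<dots> = (4 * 10 ^ 8 * ?d) * (16 * ?d ^ 6)" by (simp add: eval_nat_numeral)
      finally have "real C * real N ^ 2 * real N ^ (d - 2) \<le> (4 * 10 ^ 8 * ?d) * (16 * ?d ^ 6) * real N ^ (d - 2)"
        using N_pos by (intro mult_right_mono) auto
      then show ?thesis unfolding \<Omega>_split by (simp add: mult.assoc)
    qed
    also have "\<dots> \<le> (4 * 10 ^ 8 * ?d) * real K" by (rule mult_left_mono[OF lowK]) simp
    finally show ?thesis using d' by (simp add: field_simps)
  qed

  have 1: "real (card {gs. set gs \<subseteq> gadgets \<and> length gs = T \<and> \<not> killed (build gs) \<and> sum_list (map cost gs) \<le> M' * h})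
      \<le> exp (- ?d\<^sup>2 / 3125000) * real \<Omega> ^ T"
  proof -
    have "real (\<Omega> - K) \<le> real \<Omega> * exp (- (1 / (4 * 10 ^ 8 * ?d)))"
    proof (cases "K \<le> \<Omega>")
      case True
      then have "real (\<Omega> - K) \<le> real \<Omega> * (1 - 1 / (4 * 10 ^ 8 * ?d))"
        using K_ge by (simp add: of_nat_diff algebra_simps)
      also have "\<dots> \<le> real \<Omega> * exp (- (1 / (4 * 10 ^ 8 * ?d)))"
        using exp_ge_add_one_self[of "- (1 / (4 * 10 ^ 8 * ?d))"] by (intro mult_left_mono) auto
      finally show ?thesis .
    qed simp
    then have "real (\<Omega> - K) ^ T \<le> (real \<Omega> * exp (- (1 / (4 * 10 ^ 8 * ?d)))) ^ T"
      by (intro power_mono) auto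
    also have "\<dots> = real \<Omega> ^ T * exp (real T * - (1 / (4 * 10 ^ 8 * ?d)))"
      by (simp only: power_mult_distrib exp_of_nat_mult)
    also have "real T * - (1 / (4 * 10 ^ 8 * ?d)) = - ?d\<^sup>2 / 3125000"
      unfolding T_def using d' by (simp add: field_simps eval_nat_numeral)
    finally have "real (\<Omega> - K) ^ T \<le> real \<Omega> ^ T * exp (- ?d\<^sup>2 / 3125000)" .
    moreover have "real (card {gs. set gs \<subseteq> gadgets \<and> length gs = T \<and> \<not> killed (build gs) \<and> sum_list (map cost gs) \<le> M' * h})
      \<le> real (\<Omega> - K) ^ T"
      unfolding \<Omega>_def of_nat_power[symmetric] by (intro of_nat_mono card_unkilled) (simp add: K_def N_def)
    ultimately show ?thesis unfolding mult.commute[of "exp (- ?d\<^sup>2 / 3125000)"] by linarith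
  qed

  have 2: "real (card {gs. set gs \<subseteq> gadgets \<and> length gs = T \<and> M' * h < sum_list (map cost gs)})
      \<le> exp (- ?d\<^sup>2 / 3125000) * real \<Omega> ^ T"
  proof -
    let ?W = "real (card {gs. set gs \<subseteq> gadgets \<and> length gs = T \<and> M' * h < sum_list (map cost gs)})"
    let ?x = "1 + 1 / real (125 * d)"
    \<comment> \<open>The exponent contains \<open>d ^ 2\<close> blocks of length
      \<open>125 * d\<close>, each contributing a factor of at least 2, which exceeds
      \<open>exp (1 / 2)\<close>.\<close>
    have "exp (1 / 2 * ?d\<^sup>2) \<le> ?x ^ (M' * h)"
    proof -
      have "1 + real (125 * d) * (1 / real (125 * d)) \<le> ?x ^ (125 * d)"
        using d' by (intro Bernoulli_inequality) (simp add: field_simps)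
      then have two: "2 \<le> ?x ^ (125 * d)" using d' by simp
      have "exp (1 / 2 * ?d\<^sup>2) = exp (1 / 2) ^ (d\<^sup>2)"
        by (simp add: exp_of_nat_mult[symmetric] mult.commute)
      also have "\<dots> \<le> 2 ^ (d\<^sup>2)"
      proof (intro power_mono)
        have "(exp (1 / 2 :: real))\<^sup>2 \<le> 2\<^sup>2" using exp_le by (simp add: power2_eq_square exp_add[symmetric])
        then show "exp (1 / 2) \<le> (2 :: real)" by (rule power2_le_imp_le) simp
      qed simp
      also have "\<dots> \<le> (?x ^ (125 * d)) ^ (d\<^sup>2)" by (intro power_mono two) simp
      also have "\<dots> = ?x ^ (125 * d * d\<^sup>2)" by (simp only: power_mult)
      also have "\<dots> \<le> ?x ^ (M' * h)"
        unfolding M h by (intro power_increasing) (auto simp: power2_eq_square)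
      finally show ?thesis .
    qed
    then have "exp (1 / 2 * ?d\<^sup>2) * ?W \<le> ?x ^ (M' * h) * ?W" by (intro mult_right_mono) auto
    also have "\<dots> \<le> (\<Sum>g\<in>gadgets. ?x ^ cost g) ^ T" by (rule card_costly) simp
    also have "\<dots> \<le> (real \<Omega> * exp (1 / (400 * ?d))) ^ T"
    proof (intro power_mono)
      have Nd: "real N ^ d = real N * real N ^ (d - 1)" using d2 by (simp add: power_eq_if)
      have "(\<Sum>g\<in>gadgets. ?x ^ cost g)
          \<le> real \<Omega> + 2 / real (125 * d) * (d * N ^ (d - 1) * (200 * M' * h * card E))"
        unfolding \<Omega>_def N_def using d2 by (intro sum_power_cost) simp
      also have "2 / real (125 * d) * (d * N ^ (d - 1) * (200 * M' * h * card E))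
          = 98304 / 5 * ?d ^ 4 * real N ^ (d - 1)"
        unfolding M h cE using d' by (simp add: field_simps power_numeral_reduce)
      \<comment> \<open>The constant 400 is small enough for
        \<open>98304 / 5 * 400 \<le> 17296 * 496\<close> and large enough that the total exponent
        \<open>128 / 400 * d ^ 2\<close> stays below \<open>1 / 2 * d ^ 2\<close>.\<close>
      also have "\<dots> \<le> real \<Omega> * (1 / (400 * ?d))"
      proof -
        have "98304 / 5 * ?d ^ 4 * (400 * ?d) \<le> (17296 * ?d ^ 3) * (496 * ?d\<^sup>2)"
          by (simp add: power_numeral_reduce)
        also have "\<dots> \<le> real C * real N" using C_ge N_ge d' by (intro mult_mono) auto
        finally have "98304 / 5 * ?d ^ 4 * (400 * ?d) * real N ^ (d - 1) \<le> real C * real N * real N ^ (d - 1)"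
          using N_pos by (intro mult_right_mono) auto
        then show ?thesis using d' unfolding \<Omega>r Nd by (simp add: field_simps)
      qed
      finally have "(\<Sum>g\<in>gadgets. ?x ^ cost g) \<le> real \<Omega> * (1 + 1 / (400 * ?d))" by (simp add: algebra_simps)
      also have "\<dots> \<le> real \<Omega> * exp (1 / (400 * ?d))"
        using exp_ge_add_one_self[of "1 / (400 * ?d)"] by (intro mult_left_mono) auto
      finally show "(\<Sum>g\<in>gadgets. ?x ^ cost g) \<le> real \<Omega> * exp (1 / (400 * ?d))" .
    qed (auto intro!: sum_nonneg)
    also have "\<dots> = real \<Omega> ^ T * exp (real T * (1 / (400 * ?d)))"
      by (simp only: power_mult_distrib exp_of_nat_mult)
    also have "real T * (1 / (400 * ?d)) = 8 / 25 * ?d\<^sup>2"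
      unfolding T_def using d' by (simp add: field_simps eval_nat_numeral)
    finally have "?W \<le> real \<Omega> ^ T * exp (8 / 25 * ?d\<^sup>2) / exp (1 / 2 * ?d\<^sup>2)" by (simp add: field_simps)
    also have "\<dots> = real \<Omega> ^ T * exp (8 / 25 * ?d\<^sup>2 - 1 / 2 * ?d\<^sup>2)" by (simp only: exp_diff times_divide_eq_right)
    also have "\<dots> \<le> real \<Omega> ^ T * exp (- ?d\<^sup>2 / 3125000)" by (intro mult_left_mono) auto
    finally show ?thesis unfolding mult.commute[of "exp (- ?d\<^sup>2 / 3125000)"] .
  qed

  have fin: "finite {gs. set gs \<subseteq> gadgets \<and> length gs = T}"
    by (rule finite_lists_length_eq[OF finite_gadgets])
  let ?U = "{gs. set gs \<subseteq> gadgets \<and> length gs = T \<and> \<not> killed (build gs) \<and> sum_list (map cost gs) \<le> M' * h}"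
  let ?W = "{gs. set gs \<subseteq> gadgets \<and> length gs = T \<and> M' * h < sum_list (map cost gs)}"
  have "card {gs. set gs \<subseteq> gadgets \<and> length gs = T \<and> \<not> killed (build gs)} \<le> card (?U \<union> ?W)"
  proof (rule card_mono)
    show "finite (?U \<union> ?W)" by (rule finite_subset[OF _ fin]) auto
  qed auto
  also have "\<dots> \<le> card ?U + card ?W" by (rule card_Un_le)
  finally show ?thesis using 1 2 unfolding T_def \<Omega>_def by linarith
qed

end

section \<open>Triples with prescribed sum\<close>

locale sum_triples =
  fixes n d s :: nat and g :: "nat \<Rightarrow> nat"
  assumes n: "n = 48 * d + s" and d: "s + 4 \<le> 8 * d" and bij: "bij_betw g {..<n} {..<n}"
begin

abbreviation "A \<equiv> {..<16 * d}"
abbreviation "B \<equiv> {16 * d..<48 * d}"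
abbreviation "E \<equiv> {..<48 * d}"
abbreviation "Z \<equiv> {48 * d..<n}"

text \<open>The sum is that of the image of \<open>W \<union> Z\<close> under the injective
  \<open>g\<close>: membership says that the relabelled set belongs to the family of sets with sum
  divisible by \<open>n\<close>.\<close>

definition \<T> :: "nat set set" where
  "\<T> = {W. W \<subseteq> E \<and> card W = 3 \<and> n dvd (\<Sum>x\<in>W \<union> Z. g x)}"

lemma d_pos: "0 < d" using d by simp

lemma g_less: "x < n \<Longrightarrow> g x < n"
  using bij by (auto simp: bij_betw_def)

lemma g_eq_iff: "x < n \<Longrightarrow> y < n \<Longrightarrow> g x = g y \<longleftrightarrow> x = y"
  using bij by (auto simp: bij_betw_def inj_on_def)

lemma cong_g_imp_eq: "x < n \<Longrightarrow> y < n \<Longrightarrow> [g x = g y] (mod n) \<Longrightarrow> x = y"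
  using g_less g_eq_iff by (auto simp: unique_euclidean_semiring_class.cong_def)

lemma sum_three:
  assumes "x < 48 * d" "y < 48 * d" "z < 48 * d" "x \<noteq> y" "x \<noteq> z" "y \<noteq> z"
  shows "(\<Sum>x\<in>{x, y, z} \<union> Z. g x) = g x + g y + g z + (\<Sum>x\<in>Z. g x)"
  using assms by (subst sum.union_disjoint) auto

lemma in_\<T>_iff:
  assumes "x < 48 * d" "y < 48 * d" "z < 48 * d" "x \<noteq> y" "x \<noteq> z" "y \<noteq> z"
  shows "{x, y, z} \<in> \<T> \<longleftrightarrow> [g x + g y + g z + (\<Sum>x\<in>Z. g x) = 0] (mod n)"
  using assms sum_three[OF assms] by (simp add: \<T>_def cong_0_iff add.assoc)

lemma linear:
  assumes W: "W \<in> \<T>" "W' \<in> \<T>" "x \<in> W \<inter> W'" "y \<in> W \<inter> W'" "x \<noteq> y"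
  shows "W = W'"
proof -
  have ex: "\<exists>u. W = {x, y, u} \<and> u \<noteq> x \<and> u \<noteq> y \<and> u < 48 * d" if "W \<in> \<T>" "x \<in> W" "y \<in> W" for W
  proof -
    have "card (W - {x, y}) = 1" using that assms(5) by (simp add: \<T>_def card_Diff_subset)
    then obtain u where "W - {x, y} = {u}" by (auto simp: card_1_singleton_iff)
    then have "W = {x, y, u}" "u \<noteq> x" "u \<noteq> y" using that by auto
    then show ?thesis using that(1) by (auto simp: \<T>_def)
  qed
  obtain u where u: "W = {x, y, u}" "u \<noteq> x" "u \<noteq> y" "u < 48 * d" using ex W by blast
  obtain u' where u': "W' = {x, y, u'}" "u' \<noteq> x" "u' \<noteq> y" "u' < 48 * d" using ex W by blast
  have xy: "x < 48 * d" "y < 48 * d" using W by (auto simp: \<T>_def)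
  have "[g x + g y + g u + (\<Sum>x\<in>Z. g x) = g x + g y + g u' + (\<Sum>x\<in>Z. g x)] (mod n)"
    using W(1,2) in_\<T>_iff[of x y u] in_\<T>_iff[of x y u'] u u' xy assms(5)
    by (metis cong_sym cong_trans)
  then have "[g u = g u'] (mod n)" by (simp add: cong_add_rcancel_nat cong_add_lcancel_nat)
  then show ?thesis using u u' n by (metis cong_g_imp_eq trans_less_add1)
qed

text \<open>The only candidate for the third point of a triple through \<open>z\<close> and
  \<open>x\<close>. It ranges over all labels and may fall into \<open>Z\<close> or coincide with
  \<open>z\<close> or \<open>x\<close>; \<open>bad\<close> collects these cases.\<close>

definition partner :: "nat \<Rightarrow> nat \<Rightarrow> nat" where
  "partner z x = (SOME v. v < n \<and> [g z + g x + g v + (\<Sum>x\<in>Z. g x) = 0] (mod n))"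

lemma partner: "partner z x < n" "[g z + g x + g (partner z x) + (\<Sum>x\<in>Z. g x) = 0] (mod n)"
proof -
  let ?a = "g z + g x + (\<Sum>x\<in>Z. g x)"
  have n0: "0 < n" using n d_pos by simp
  \<comment> \<open>The residue of \<open>- ?a\<close>; the outer \<open>mod\<close> matters when
    \<open>n\<close> divides \<open>?a\<close>.\<close>
  let ?t = "(n - ?a mod n) mod n"
  have "?t \<in> g ` {..<n}" using bij n0 by (auto simp: bij_betw_def)
  then obtain v where v: "v < n" "g v = ?t" by auto
  have "[?a + ?t = ?a mod n + (n - ?a mod n)] (mod n)" by (intro cong_add) (auto simp: unique_euclidean_semiring_class.cong_def)
  moreover have "?a mod n + (n - ?a mod n) = n" using n0 by (simp add: le_simps(1))
  ultimately have "[g z + g x + g v + (\<Sum>x\<in>Z. g x) = 0] (mod n)"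
    using v by (simp add: unique_euclidean_semiring_class.cong_def add_ac)
  then have "\<exists>v. v < n \<and> [g z + g x + g v + (\<Sum>x\<in>Z. g x) = 0] (mod n)" using v by blast
  from someI_ex[OF this] show "partner z x < n" "[g z + g x + g (partner z x) + (\<Sum>x\<in>Z. g x) = 0] (mod n)"
    unfolding partner_def by auto
qed

lemma inj_partner: "inj_on (partner z) {..<n}"
proof (rule inj_onI)
  fix x y assume xy: "x \<in> {..<n}" "y \<in> {..<n}" and eq: "partner z x = partner z y"
  have "[g z + g x + g (partner z x) + (\<Sum>x\<in>Z. g x) = g z + g y + g (partner z x) + (\<Sum>x\<in>Z. g x)] (mod n)"
    using partner(2)[of z x] partner(2)[of z y] eq by (metis cong_sym cong_trans)
  then have "[g x = g y] (mod n)" by (simp add: cong_add_rcancel_nat cong_add_lcancel_nat)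
  then show "x = y" using xy cong_g_imp_eq by auto
qed

definition bad :: "nat \<Rightarrow> nat set" where
  "bad z = {x \<in> E - {z}. partner z x \<in> Z \<or> partner z x = z \<or> partner z x = x}"

lemma card_partner_in: "X \<subseteq> {..<n} \<Longrightarrow> finite Y \<Longrightarrow> card {x \<in> X. partner z x \<in> Y} \<le> card Y"
  by (rule card_inj_on_le[of "partner z"]) (auto intro: inj_on_subset[OF inj_partner])

text \<open>For a fixed point \<open>x\<close>, the number \<open>2 * g x\<close> has a prescribed
  residue and is less than \<open>2 * n\<close>, which leaves two values.\<close>

lemma card_fixed: "card {x \<in> E. partner z x = x} \<le> 2"
proof -
  let ?a = "g z + (\<Sum>x\<in>Z. g x)"
  let ?F = "{x \<in> E. partner z x = x}"
  have "g x \<in> {(n - ?a mod n) mod n div 2, ((n - ?a mod n) mod n + n) div 2}" if x: "x \<in> ?F" for x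
  proof -
    have xn: "x < n" using x n by simp
    have n0: "0 < n" using xn by simp
    have "[?a + 2 * g x = 0] (mod n)"
      using partner(2)[of z x] x by (simp add: add_ac mult_2)
    moreover have "[?a + (n - ?a mod n) mod n = 0] (mod n)"
    proof -
      have "[?a + (n - ?a mod n) mod n = ?a mod n + (n - ?a mod n)] (mod n)" by (intro cong_add) (auto simp: unique_euclidean_semiring_class.cong_def)
      moreover have "?a mod n + (n - ?a mod n) = n" using n0 by (simp add: le_simps(1))
      ultimately show ?thesis by (simp add: unique_euclidean_semiring_class.cong_def)
    qed
    ultimately have "[?a + 2 * g x = ?a + (n - ?a mod n) mod n] (mod n)" by (metis cong_sym cong_trans)
    then have c: "[2 * g x = (n - ?a mod n) mod n] (mod n)" by (simp only: cong_add_lcancel_nat)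
    then have e: "(2 * g x) mod n = (n - ?a mod n) mod n" by (simp add: unique_euclidean_semiring_class.cong_def)
    have "2 * g x < 2 * n" using g_less[OF xn] by simp
    then have "2 * g x = (n - ?a mod n) mod n \<or> 2 * g x = (n - ?a mod n) mod n + n"
    proof (cases "2 * g x < n")
      case False
      then have "(2 * g x) mod n = 2 * g x - n" using \<open>2 * g x < 2 * n\<close> by (simp add: mod_if)
      then show ?thesis using e False by simp
    qed (use e in simp)
    then have "g x = (n - ?a mod n) mod n div 2 \<or> g x = ((n - ?a mod n) mod n + n) div 2" by linarith
    then show ?thesis by simp
  qed
  then have "g ` ?F \<subseteq> {(n - ?a mod n) mod n div 2, ((n - ?a mod n) mod n + n) div 2}" by blast
  then have "card (g ` ?F) \<le> card {(n - ?a mod n) mod n div 2, ((n - ?a mod n) mod n + n) div 2}"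
    by (rule card_mono[rotated]) simp
  also have "\<dots> \<le> 2" by (simp add: card_insert_if)
  also have "card (g ` ?F) = card ?F"
    using n g_eq_iff by (intro card_image inj_onI) auto
  finally show ?thesis by simp
qed

lemma finite_bad: "finite (bad z)" by (simp add: bad_def)

lemma card_bad: "card (bad z) \<le> s + 3"
proof -
  have "bad z \<subseteq> {x \<in> E. partner z x \<in> Z} \<union> {x \<in> E. partner z x \<in> {z}} \<union> {x \<in> E. partner z x = x}"
    by (auto simp: bad_def)
  then have "card (bad z) \<le> card ({x \<in> E. partner z x \<in> Z} \<union> {x \<in> E. partner z x \<in> {z}} \<union> {x \<in> E. partner z x = x})"
    by (intro card_mono) auto
  also have "\<dots> \<le> card {x \<in> E. partner z x \<in> Z} + card {x \<in> E. partner z x \<in> {z}} + card {x \<in> E. partner z x = x}"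
    by (meson card_Un_le add_le_mono le_refl order_trans)
  also have "\<dots> \<le> card Z + card {z} + 2"
    using n by (intro add_le_mono card_partner_in card_fixed) auto
  also have "\<dots> = s + 3" using n by simp
  finally show ?thesis .
qed

lemma partner_\<T>:
  assumes "z \<in> E" "x \<in> E - {z}" "x \<notin> bad z"
  shows "{z, x, partner z x} \<in> \<T>" "partner z x \<in> E - {z, x}"
proof -
  show p: "partner z x \<in> E - {z, x}" using assms partner(1)[of z x] by (auto simp: bad_def)
  then show "{z, x, partner z x} \<in> \<T>" using assms partner(2)[of z x] by (subst in_\<T>_iff) auto
qed

definition petals :: "nat \<Rightarrow> nat set set" where
  "petals z = {P. P \<subseteq> B \<and> card P = 2 \<and> insert z P \<in> \<T>}"

lemma finite_petals: "finite (petals z)"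
  by (rule finite_subset[of _ "Pow B"]) (auto simp: petals_def)

text \<open>Injectivity of \<open>partner\<close> allows at most \<open>16 * d\<close> partners in
  \<open>A\<close>. As \<open>B\<close> is twice as large, at least \<open>16 * d - (s + 4)\<close>
  points of \<open>B\<close> have a suitable partner in \<open>B\<close>; this is at least
  \<open>8 * d\<close>, and a petal covers two of them.\<close>

lemma card_petals:
  assumes z: "z \<in> B" shows "4 * d \<le> card (petals z)"
proof -
  let ?X = "B - {z} - bad z - {x \<in> E. partner z x \<in> A}"
  have zE: "z \<in> E" using z by simp
  have "?X \<subseteq> \<Union>(petals z)"
  proof
    fix x assume x: "x \<in> ?X"
    then have xE: "x \<in> E - {z}" "x \<notin> bad z" by auto
    note p = partner_\<T>[OF zE xE]
    have "partner z x \<in> B" using p(2) x by auto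
    then have "{x, partner z x} \<in> petals z" using p x by (auto simp: petals_def)
    then show "x \<in> \<Union>(petals z)" by blast
  qed
  moreover have fin: "finite (\<Union>(petals z))"
    using finite_petals by (rule finite_Union) (auto simp: petals_def intro: finite_subset)
  ultimately have "card ?X \<le> card (\<Union>(petals z))" by (intro card_mono)
  also have "\<dots> \<le> (\<Sum>P\<in>petals z. card P)" by (rule card_Union_le_sum_card)
  also have "\<dots> = 2 * card (petals z)" by (simp add: petals_def)
  finally have le: "card ?X \<le> 2 * card (petals z)" .
  have "card (B - {z}) - card (bad z) - card {x \<in> E. partner z x \<in> A} \<le> card ?X"
    using diff_card_le_card_Diff[OF finite_bad[of z], of "B - {z}"]
      diff_card_le_card_Diff[of "{x \<in> E. partner z x \<in> A}" "B - {z} - bad z"] by simp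
  moreover have "card {x \<in> E. partner z x \<in> A} \<le> 16 * d"
    using card_partner_in[of E A z] n by simp
  moreover have "card (B - {z}) = 32 * d - 1" using z by simp
  ultimately show ?thesis using le card_bad[of z] d by linarith
qed

definition centers :: "nat set set" where
  "centers = {W \<in> \<T>. W \<inter> A \<noteq> {} \<and> W \<inter> B \<noteq> {}}"

lemma finite_centers: "finite centers"
  by (rule finite_subset[of _ "Pow E"]) (auto simp: centers_def \<T>_def)

text \<open>Pairs of a point of \<open>B\<close> and a point of \<open>A\<close> that is not bad for
  it are counted; a triple meeting both sides contains exactly two pairs across them.\<close>

lemma card_centers: "128 * d\<^sup>2 \<le> card centers"
proof -
  let ?Q = "SIGMA z:B. A - bad z"
  have "?Q \<subseteq> (\<Union>W\<in>centers. (W \<inter> B) \<times> (W \<inter> A))"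
  proof
    fix q assume "q \<in> ?Q"
    then obtain z x where q: "q = (z, x)" "z \<in> B" "x \<in> A" "x \<notin> bad z" by auto
    have "{z, x, partner z x} \<in> \<T>" using q by (intro partner_\<T>) auto
    then have "{z, x, partner z x} \<in> centers" using q by (auto simp: centers_def)
    then show "q \<in> (\<Union>W\<in>centers. (W \<inter> B) \<times> (W \<inter> A))" using q by blast
  qed
  then have "card ?Q \<le> card (\<Union>W\<in>centers. (W \<inter> B) \<times> (W \<inter> A))"
    using finite_centers by (intro card_mono) auto
  also have "\<dots> \<le> (\<Sum>W\<in>centers. card ((W \<inter> B) \<times> (W \<inter> A)))" by (rule card_UN_le[OF finite_centers])
  also have "\<dots> \<le> (\<Sum>W\<in>centers. 2)"
  proof (rule sum_mono)
    fix W assume W: "W \<in> centers"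
    then have WE: "W \<subseteq> E" "card W = 3" by (auto simp: centers_def \<T>_def)
    then have fin: "finite W" by (auto intro: finite_subset)
    have "W = (W \<inter> B) \<union> (W \<inter> A)" using WE by auto
    moreover have "card ((W \<inter> B) \<union> (W \<inter> A)) = card (W \<inter> B) + card (W \<inter> A)"
      using fin by (intro card_Un_disjoint) auto
    ultimately have c: "card (W \<inter> B) + card (W \<inter> A) = 3" using WE by simp
    moreover have "card (W \<inter> B) \<noteq> 0" "card (W \<inter> A) \<noteq> 0" using W fin by (auto simp: centers_def)
    ultimately consider "card (W \<inter> B) = 1" "card (W \<inter> A) = 2" | "card (W \<inter> B) = 2" "card (W \<inter> A) = 1"
      by linarith
    then show "card ((W \<inter> B) \<times> (W \<inter> A)) \<le> 2" by cases (simp_all add: card_cartesian_product)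
  qed
  also have "\<dots> = 2 * card centers" by simp
  finally have le: "card ?Q \<le> 2 * card centers" .
  have "card ?Q = (\<Sum>z\<in>B. card (A - bad z))" by (rule card_SigmaI) auto
  also have "\<dots> \<ge> (\<Sum>z\<in>B. 8 * d)"
  proof (rule sum_mono)
    fix z
    have "card A - card (bad z) \<le> card (A - bad z)" by (rule diff_card_le_card_Diff[OF finite_bad])
    then show "8 * d \<le> card (A - bad z)" using card_bad[of z] d by simp
  qed
  finally have "32 * d * (8 * d) \<le> card ?Q" by simp
  then show ?thesis using le by (simp add: power2_eq_square)
qed

definition violates :: "nat set set \<Rightarrow> bool" where
  "violates \<H> \<longleftrightarrow> (\<exists>S1\<in>\<T>. \<exists>S2\<in>\<T>. \<exists>S3\<in>\<T>. S1 \<union> S2 \<in> \<H> \<and> S2 \<union> S3 \<in> \<H> \<and>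
    S1 \<union> S3 \<subseteq> B \<and> card (S1 \<union> S3) = 5)"

lemma obtain_target:
  obtains \<C> \<zeta> good where "star_target E A B \<T> \<C> \<zeta> good (2 * d) (64 * d\<^sup>2)"
    "\<And>\<H>. star_target.killed \<C> good \<H> \<Longrightarrow> violates \<H>"
proof -
  obtain \<C> where \<C>: "\<C> \<subseteq> centers" "card \<C> = 128 * d\<^sup>2"
    using card_centers by (rule obtain_subset_with_card_n)
  define \<zeta> where "\<zeta> W = (SOME z. z \<in> W \<inter> B)" for W
  have \<zeta>: "\<zeta> W \<in> W \<inter> B" if "W \<in> \<C>" for W
  proof -
    have "\<exists>z. z \<in> W \<inter> B" using that \<C>(1) unfolding centers_def by blast
    then show ?thesis unfolding \<zeta>_def by (rule someI_ex)
  qed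
  have "\<forall>W\<in>\<C>. \<exists>G. G \<subseteq> petals (\<zeta> W) \<and> card G = 4 * d"
  proof
    fix W assume "W \<in> \<C>"
    then have "4 * d \<le> card (petals (\<zeta> W))" using \<zeta> by (intro card_petals) blast
    then show "\<exists>G. G \<subseteq> petals (\<zeta> W) \<and> card G = 4 * d" by (meson obtain_subset_with_card_n)
  qed
  from bchoice[OF this] obtain good
    where goodP: "\<And>W. W \<in> \<C> \<Longrightarrow> good W \<subseteq> petals (\<zeta> W)" "\<And>W. W \<in> \<C> \<Longrightarrow> card (good W) = 4 * d"
    by blast
  interpret star_target E A B d \<T> \<C> \<zeta> good "2 * d" "64 * d\<^sup>2"
  proof
    show "E = A \<union> B" "A \<inter> B = {}" by auto
    show "W = W'" if "W \<in> \<T>" "W' \<in> \<T>" "x \<in> W \<inter> W'" "y \<in> W \<inter> W'" "x \<noteq> y" for W W' x y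
      by (rule linear[OF that])
    show "W \<in> \<T> \<and> W \<subseteq> E \<and> card W = 3 \<and> W \<inter> A \<noteq> {} \<and> \<zeta> W \<in> W \<inter> B" if "W \<in> \<C>" for W
      using that \<C>(1) \<zeta> by (auto simp: centers_def \<T>_def)
    show "P \<subseteq> B \<and> card P = 2 \<and> insert (\<zeta> W) P \<in> \<T> \<and> W \<inter> P = {}" if W: "W \<in> \<C>" and P: "P \<in> good W" for W P
    proof -
      have p: "P \<subseteq> B" "card P = 2" "insert (\<zeta> W) P \<in> \<T>"
        using goodP(1)[OF W] P by (auto simp: petals_def)
      have z: "\<zeta> W \<in> W" "\<zeta> W \<in> B" using \<zeta>[OF W] by auto
      have zP: "\<zeta> W \<notin> P" using p by (auto simp: \<T>_def insert_absorb)
      \<comment> \<open>A second common point would identify \<open>W\<close> with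
        \<open>insert (\<zeta> W) P\<close>, which lies in \<open>B\<close>, whereas centers meet
        \<open>A\<close>.\<close>
      have "W \<inter> P = {}"
      proof (rule ccontr)
        assume "W \<inter> P \<noteq> {}"
        then obtain y where y: "y \<in> W" "y \<in> P" by blast
        have "W \<in> \<T>" "W \<inter> A \<noteq> {}" using W \<C>(1) by (auto simp: centers_def)
        then have "W = insert (\<zeta> W) P" using linear[of W "insert (\<zeta> W) P" y "\<zeta> W"] p y z zP by auto
        moreover have "insert (\<zeta> W) P \<subseteq> B" using p z by blast
        ultimately have "W \<subseteq> B" by metis
        then show False using \<open>W \<inter> A \<noteq> {}\<close> by auto
      qed
      then show ?thesis using p by blast
    qed
    show "card \<C> = 2 * (64 * d\<^sup>2)" using \<C>(2) by simp
    show "card (good W) = 2 * (2 * d)" if "W \<in> \<C>" for W using goodP(2)[OF that] by simp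
    show "0 < 2 * d" using d_pos by simp
  qed simp
  have "violates \<H>" if "killed \<H>" for \<H>
    using killed_imp_path[OF that] unfolding violates_def .
  then show thesis using that star_target_axioms by blast
qed

end

section \<open>Choice of \<open>d\<close> and union bound over all relabellings\<close>

lemma exists_dimension:
  "\<exists>d. 2 \<le> d \<and> s \<le> d \<and> s + 4 \<le> 8 * d \<and> real (49 * d) ^ (49 * d) * (2 * exp (- (real d)\<^sup>2 / 3125000)) < 1"
proof -
  \<comment> \<open>On the logarithmic scale, \<open>49 * d * ln (49 * d)\<close> is eventually
    outweighed by any positive multiple of \<open>d ^ 2\<close>.\<close>
  have "((\<lambda>d. (49 * d) powr (49 * d) * (2 * exp (- d\<^sup>2 / 3125000))) \<longlongrightarrow> (0 :: real)) at_top"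
    by real_asymp
  then have "((\<lambda>d. (49 * real d) powr (49 * real d) * (2 * exp (- (real d)\<^sup>2 / 3125000))) \<longlongrightarrow> 0) sequentially"
    by (rule filterlim_compose[OF _ filterlim_real_sequentially])
  then have "eventually (\<lambda>d. (49 * real d) powr (49 * real d) * (2 * exp (- (real d)\<^sup>2 / 3125000)) < 1) sequentially"
    by (rule order_tendstoD) simp
  moreover have "eventually (\<lambda>d. s + 2 \<le> d) sequentially" by (rule eventually_ge_at_top)
  ultimately obtain d where d: "s + 2 \<le> d"
    "(49 * real d) powr (49 * real d) * (2 * exp (- (real d)\<^sup>2 / 3125000)) < 1"
    using eventually_conj eventually_happens trivial_limit_sequentially by (metis (no_types, lifting))
  have "real (49 * d) powr real (49 * d) = real (49 * d) ^ (49 * d)"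
    using d(1) by (intro powr_realpow) simp
  then have "real (49 * d) ^ (49 * d) * (2 * exp (- (real d)\<^sup>2 / 3125000)) < 1"
    using d(2) by (simp only: of_nat_mult of_nat_numeral)
  then show ?thesis using d(1) by (intro exI[of _ d]) simp
qed

context sum_triples
begin

lemma card_not_violating:
  assumes "2 \<le> d"
  shows "real (card {gs. set gs \<subseteq> star_process.gadgets E B d \<and> length gs = 128 * d ^ 3 \<and>
      \<not> violates (star_process.build A d gs)})
    \<le> 2 * exp (- (real d)\<^sup>2 / 3125000) * real (card (star_process.gadgets E B d)) ^ (128 * d ^ 3)"
proof -
  obtain \<C> \<zeta> good where t: "star_target E A B \<T> \<C> \<zeta> good (2 * d) (64 * d\<^sup>2)"
    and v: "\<And>\<H>. star_target.killed \<C> good \<H> \<Longrightarrow> violates \<H>"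
    by (rule obtain_target, rule that)
  interpret star_target E A B d \<T> \<C> \<zeta> good "2 * d" "64 * d\<^sup>2" by (rule t)
  have fin: "finite {gs. set gs \<subseteq> gadgets \<and> length gs = 128 * d ^ 3}"
    by (rule finite_lists_length_eq[OF finite_gadgets])
  have "card {gs. set gs \<subseteq> gadgets \<and> length gs = 128 * d ^ 3 \<and> \<not> violates (build gs)}
      \<le> card {gs. set gs \<subseteq> gadgets \<and> length gs = 128 * d ^ 3 \<and> \<not> killed (build gs)}"
  proof (rule card_mono)
    show "finite {gs. set gs \<subseteq> gadgets \<and> length gs = 128 * d ^ 3 \<and> \<not> killed (build gs)}"
      by (rule finite_subset[OF _ fin]) auto
  qed (use v in auto)
  also have "real (card {gs. set gs \<subseteq> gadgets \<and> length gs = 128 * d ^ 3 \<and> \<not> killed (build gs)})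
      \<le> 2 * exp (- (real d)\<^sup>2 / 3125000) * real (card gadgets) ^ (128 * d ^ 3)"
    by (rule card_bad_lists) (use assms in simp_all)
  finally show ?thesis by simp
qed

end

text \<open>Relabellings are arbitrary outside \<open>{..<n}\<close>. This reduces them to
  extensional functions, of which there are finitely many, as the union bound demands.\<close>

lemma sum_triples_\<T>_cong:
  assumes "sum_triples n d s g" "sum_triples n d s g'" "\<And>x. x < n \<Longrightarrow> g x = g' x"
  shows "sum_triples.\<T> n d g = sum_triples.\<T> n d g'"
proof -
  interpret sum_triples n d s g by fact
  have "(\<Sum>x\<in>W \<union> {48 * d..<n}. g x) = (\<Sum>x\<in>W \<union> {48 * d..<n}. g' x)" if "W \<subseteq> {..<48 * d}" for W
    using assms(3) n that by (intro sum.cong) auto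
  then show ?thesis unfolding \<T>_def sum_triples.\<T>_def[OF assms(2)] by auto
qed

lemma exists_universal_gadget_list:
  assumes n: "n = 48 * d + s" and d: "2 \<le> d" "s \<le> d" "s + 4 \<le> 8 * d"
    and small: "real (49 * d) ^ (49 * d) * (2 * exp (- (real d)\<^sup>2 / 3125000)) < 1"
  shows "\<exists>gs. set gs \<subseteq> star_process.gadgets {..<48 * d} {16 * d..<48 * d} d \<and>
    (\<forall>g. bij_betw g {..<n} {..<n} \<longrightarrow> sum_triples.violates n d g (star_process.build {..<16 * d} d gs))"
proof -
  interpret star_process "{..<48 * d}" "{..<16 * d}" "{16 * d..<48 * d}" d
    by unfold_locales auto
  define L where "L = {gs. set gs \<subseteq> gadgets \<and> length gs = 128 * d ^ 3}"
  define G where "G = {g \<in> {..<n} \<rightarrow>\<^sub>E {..<n}. bij_betw g {..<n} {..<n}}"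
  define missed where "missed g = {gs \<in> L. \<not> sum_triples.violates n d g (build gs)}" for g
  let ?e = "2 * exp (- (real d)\<^sup>2 / 3125000)"
  have finL: "finite L" unfolding L_def by (rule finite_lists_length_eq[OF finite_gadgets])
  have cardL: "card L = card gadgets ^ (128 * d ^ 3)" unfolding L_def by (rule card_lists_length_eq[OF finite_gadgets])
  have finP: "finite ({..<n} \<rightarrow>\<^sub>E {..<n})" by (intro finite_PiE) auto
  then have finG: "finite G" unfolding G_def by simp
  have "card G \<le> card ({..<n} \<rightarrow>\<^sub>E {..<n})" unfolding G_def by (rule card_mono[OF finP]) auto
  also have "\<dots> = n ^ n" by (simp add: card_PiE)
  \<comment> \<open>The factor 49 absorbs \<open>s \<le> d\<close> in
    \<open>n = 48 * d + s\<close>.\<close>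
  also have "\<dots> \<le> (49 * d) ^ n" using n d by (intro power_mono) auto
  also have "\<dots> \<le> (49 * d) ^ (49 * d)" using n d by (intro power_increasing) auto
  finally have cardG: "card G \<le> (49 * d) ^ (49 * d)" .
  have cb: "real (card (missed g)) \<le> ?e * real (card L)" if "g \<in> G" for g
  proof -
    interpret sum_triples n d s g using n d that by unfold_locales (auto simp: G_def)
    show ?thesis using card_not_violating[OF \<open>2 \<le> d\<close>] unfolding missed_def L_def cardL[unfolded L_def]
      by (simp add: conj_assoc)
  qed
  have "card gadgets = ((48 * d) choose 3) * ((32 * d) choose 2) ^ d"
    unfolding gadgets_def triples_def pairs_def
    using n_subsets[of "{..<48 * d}" 3] n_subsets[of "{16 * d..<48 * d}" 2]
    by (simp add: card_cartesian_product card_PiE)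
  then have "0 < card gadgets" using d by simp
  then have L_pos: "0 < real (card L)" unfolding cardL by simp
  have "card (\<Union>g\<in>G. missed g) \<le> (\<Sum>g\<in>G. card (missed g))" by (rule card_UN_le[OF finG])
  then have "real (card (\<Union>g\<in>G. missed g)) \<le> (\<Sum>g\<in>G. real (card (missed g)))"
    by (metis of_nat_mono of_nat_sum)
  also have "\<dots> \<le> (\<Sum>g\<in>G. ?e * real (card L))" by (intro sum_mono cb)
  also have "\<dots> = real (card G) * ?e * real (card L)" by simp
  also have "\<dots> \<le> real (49 * d) ^ (49 * d) * ?e * real (card L)"
    using of_nat_mono[OF cardG, where 'a = real] unfolding of_nat_power by (intro mult_right_mono) auto
  also have "\<dots> < 1 * real (card L)" by (rule mult_strict_right_mono[OF small L_pos])
  finally have "card (\<Union>g\<in>G. missed g) < card L" by simp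
  then have "\<not> L \<subseteq> (\<Union>g\<in>G. missed g)"
    using card_mono[of "\<Union>g\<in>G. missed g" L] finG finL by (auto simp: missed_def)
  then obtain gs where gs: "gs \<in> L" "\<And>g. g \<in> G \<Longrightarrow> gs \<notin> missed g" by blast
  have "sum_triples.violates n d g (build gs)" if g: "bij_betw g {..<n} {..<n}" for g
  proof -
    let ?g = "restrict g {..<n}"
    have "bij_betw ?g {..<n} {..<n}" using g bij_betw_cong[of "{..<n}" ?g g "{..<n}"] by simp
    then have "?g \<in> G" using bij_betwE[OF g] by (simp add: G_def restrict_PiE_iff)
    then have v: "sum_triples.violates n d ?g (build gs)" using gs by (auto simp: missed_def)
    interpret g: sum_triples n d s g using n d g by unfold_locales
    interpret g': sum_triples n d s ?g using n d \<open>?g \<in> G\<close> by unfold_locales (auto simp: G_def)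
    have "sum_triples.\<T> n d ?g = sum_triples.\<T> n d g"
      by (rule sum_triples_\<T>_cong[OF g'.sum_triples_axioms g.sum_triples_axioms]) simp
    then show ?thesis using v unfolding g.violates_def g'.violates_def by simp
  qed
  then show ?thesis using gs(1) by (auto simp: L_def)
qed

section \<open>From 5-sets to rank \<open>r\<close>: padding by \<open>Z\<close> and transport along
  a relabelling\<close>

theorem theorem1p3:
  fixes r :: nat
  assumes "r \<ge> 5"
  shows "\<exists>(K :: nat rank_system) X.
    matroid K \<and> matroid_rank K = r \<and> sparse_paving K \<and> \<not> representable K \<and>
    X \<subseteq> ground K \<and> card X = 2 \<and>
    \<not> (\<exists>N :: nat set rank_system.
        matroid N \<and> ground N = matroid_circuits (matroid_contract K X) \<and>
        modular_pair_condition (matroid_contract K X) N \<and>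
        matroid_isomorphic (matroid_lift (matroid_contract K X) N) (matroid_delete K X))"
proof -
  define s where "s = r - 5"
  have r_eq: "r = s + 5" using assms by (simp add: s_def)
  obtain d where d: "2 \<le> d" "s \<le> d" "s + 4 \<le> 8 * d"
    and small: "real (49 * d) ^ (49 * d) * (2 * exp (- (real d)\<^sup>2 / 3125000)) < 1"
    using exists_dimension by blast
  define n where "n = 48 * d + s"
  define V where "V = {..<n}"
  define Z where "Z = {48 * d..<n}"
  interpret star_process "{..<48 * d}" "{..<16 * d}" "{16 * d..<48 * d}" d
    by unfold_locales auto
  obtain gs where gs: "set gs \<subseteq> gadgets"
    and viol: "\<And>g. bij_betw g V V \<Longrightarrow> sum_triples.violates n d g (build gs)"
    using exists_universal_gadget_list[OF n_def d small] unfolding V_def by blast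
  define \<S> where "\<S> = {S. S \<subseteq> V \<and> card S = r - 2 \<and> n dvd \<Sum>S}"
  define \<H> where "\<H> = (\<lambda>H. H \<union> Z) ` build gs"
  have cardZ: "card Z = s" "finite Z" "Z \<subseteq> V" by (auto simp: Z_def n_def V_def)
  have EV: "{..<48 * d} \<subseteq> V" "{..<48 * d} \<inter> Z = {}" by (auto simp: V_def n_def Z_def)
  have card_Un_Z: "card (W \<union> Z) = card W + s" if "W \<subseteq> {..<48 * d}" for W
  proof -
    have "finite W" using that finite_subset by blast
    moreover have "W \<inter> Z = {}" using that EV(2) by blast
    ultimately show ?thesis using cardZ by (simp add: card_Un_disjoint)
  qed
  have H: "H \<subseteq> {..<48 * d}" "card H = 5" "H \<inter> {..<16 * d} \<noteq> {}" if "H \<in> build gs" for H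
    using build_D[OF gs that] by auto
  have spread_S: "spread (r - 2) \<S>"
  proof -
    \<comment> \<open>Otherwise the sets differ by one exchange, and the exchanged elements, both
      below \<open>n\<close>, would be congruent modulo \<open>n\<close>.\<close>
    have "card (S \<inter> S') + 2 \<le> r - 2" if S: "S \<in> \<S>" "S' \<in> \<S>" "S \<noteq> S'" for S S'
    proof (rule ccontr)
      assume "\<not> card (S \<inter> S') + 2 \<le> r - 2"
      then have c: "s + 2 \<le> card (S \<inter> S')" using r_eq by simp
      have fin: "finite S" "finite S'" using S finite_subset[of _ V] by (auto simp: \<S>_def V_def)
      have cS: "card S = s + 3" "card S' = s + 3" using S r_eq by (auto simp: \<S>_def)
      have "S \<inter> S' \<noteq> S" using S(3) cS fin card_subset_eq[of S' S] by auto
      then have "card (S \<inter> S') < card S" using fin by (intro psubset_card_mono) auto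
      then have "card (S - S') = 1" "card (S' - S) = 1"
        using c cS fin card_Diff_subset_Int[of S S'] card_Diff_subset_Int[of S' S] by (auto simp: Int_commute)
      then obtain u u' where u: "S - S' = {u}" "S' - S = {u'}" by (auto simp: card_1_singleton_iff)
      have "\<Sum>S = \<Sum>(S \<inter> S') + u" "\<Sum>S' = \<Sum>(S \<inter> S') + u'"
        using sum.Int_Diff[OF fin(1), of "\<lambda>x. x" S'] sum.Int_Diff[OF fin(2), of "\<lambda>x. x" S] u
        by (simp_all add: Int_commute)
      moreover have "[\<Sum>S = 0] (mod n)" "[\<Sum>S' = 0] (mod n)" using S by (auto simp: \<S>_def cong_0_iff)
      ultimately have "[\<Sum>(S \<inter> S') + u = \<Sum>(S \<inter> S') + u'] (mod n)" by (metis cong_sym cong_trans)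
      then have "[u = u'] (mod n)" by (simp only: cong_add_lcancel_nat)
      moreover have "u \<in> S" "u' \<in> S'" "u \<notin> S'" using u by blast+
      then have "u < n" "u' < n" "u \<noteq> u'" using S by (auto simp: \<S>_def V_def)
      ultimately show False by (simp add: unique_euclidean_semiring_class.cong_def)
    qed
    then show ?thesis unfolding spread_def by (auto simp: \<S>_def V_def intro: finite_subset)
  qed
  have spread_H: "spread r \<H>"
  proof -
    have "card ((H \<union> Z) \<inter> (H' \<union> Z)) + 2 \<le> r"
      if HH: "H \<in> build gs" "H' \<in> build gs" "H \<union> Z \<noteq> H' \<union> Z" for H H'
    proof -
      have "card (H \<inter> H') \<le> 3" using HH by (intro build_spread[OF gs]) auto
      moreover have "(H \<union> Z) \<inter> (H' \<union> Z) = H \<inter> H' \<union> Z" by blast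
      moreover have "card (H \<inter> H' \<union> Z) = card (H \<inter> H') + s" using H(1)[OF HH(1)] by (intro card_Un_Z) blast
      ultimately show ?thesis using r_eq by simp
    qed
    moreover have "finite (H \<union> Z) \<and> card (H \<union> Z) = r" if "H \<in> build gs" for H
      using H[OF that] card_Un_Z cardZ r_eq finite_subset[of H "{..<48 * d}"] by auto
    ultimately show ?thesis unfolding spread_def \<H>_def by blast
  qed
  interpret lift_data V "{n, n + 1}" r \<S> \<H>
  proof
    show "\<H> \<subseteq> Pow V" using H(1) EV cardZ by (auto simp: \<H>_def)
    show "r < card V + 2" using r_eq d by (simp add: V_def n_def)
  qed (use spread_S spread_H assms in \<open>auto simp: V_def \<S>_def\<close>)
  have "\<exists>S1\<in>\<S>. \<exists>S2\<in>\<S>. \<exists>S3\<in>\<S>.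
      f ` (S1 \<union> S2) \<in> \<H> \<and> f ` (S2 \<union> S3) \<in> \<H> \<and> f ` (S1 \<union> S3) \<notin> \<H> \<and> card (S1 \<union> S3) = r"
    if f: "bij_betw f V V" for f
  proof -
    \<comment> \<open>Membership in \<open>\<H>\<close> is tested after \<open>f\<close> and
      membership in \<open>\<S>\<close> before it, so the path found among sets
      \<open>W \<union> Z\<close> has to be pulled back along \<open>f\<close>.\<close>
    define g where "g = inv_into V f"
    have g: "bij_betw g V V" unfolding g_def by (rule bij_betw_inv_into[OF f])
    have fg: "f ` g ` Y = Y" if "Y \<subseteq> V" for Y
      using that f unfolding g_def by (simp add: bij_betw_def image_inv_into_cancel)
    have inj: "inj_on g Y" if "Y \<subseteq> V" for Y using g that by (auto simp: bij_betw_def intro: inj_on_subset)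
    interpret g: sum_triples n d s g using n_def d g by unfold_locales (auto simp: V_def)
    have lift: "g ` (W \<union> Z) \<in> \<S>" if W: "W \<in> g.\<T>" for W
    proof -
      have WE: "W \<subseteq> {..<48 * d}" "card W = 3" "n dvd (\<Sum>x\<in>W \<union> Z. g x)"
        using W by (auto simp: g.\<T>_def Z_def)
      have WV: "W \<union> Z \<subseteq> V" using WE EV cardZ by blast
      have "g ` (W \<union> Z) \<subseteq> V" using g WV by (auto simp: bij_betw_def)
      moreover have "card (g ` (W \<union> Z)) = r - 2"
        using card_image[OF inj[OF WV]] card_Un_Z[OF WE(1)] WE(2) r_eq by simp
      moreover have "\<Sum>(g ` (W \<union> Z)) = (\<Sum>x\<in>W \<union> Z. g x)"
        using sum.reindex[OF inj[OF WV], of "\<lambda>x. x"] by simp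
      ultimately show ?thesis using WE(3) by (simp add: \<S>_def)
    qed
    obtain W1 W2 W3 where W: "W1 \<in> g.\<T>" "W2 \<in> g.\<T>" "W3 \<in> g.\<T>"
      and HW: "W1 \<union> W2 \<in> build gs" "W2 \<union> W3 \<in> build gs"
      and B: "W1 \<union> W3 \<subseteq> {16 * d..<48 * d}" "card (W1 \<union> W3) = 5"
      using viol[OF g] unfolding g.violates_def by blast
    have WE: "W1 \<subseteq> {..<48 * d}" "W2 \<subseteq> {..<48 * d}" "W3 \<subseteq> {..<48 * d}"
      using W by (auto simp: g.\<T>_def)
    have un: "f ` (g ` (W \<union> Z) \<union> g ` (W' \<union> Z)) = W \<union> W' \<union> Z"
      if "W \<subseteq> {..<48 * d}" "W' \<subseteq> {..<48 * d}" for W W'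
    proof -
      have "W \<union> Z \<subseteq> V" "W' \<union> Z \<subseteq> V" using that EV cardZ by blast+
      then show ?thesis unfolding image_Un[of f] by (simp only: fg) blast
    qed
    \<comment> \<open>Every 5-set of \<open>build gs\<close> meets \<open>{..<16 * d}\<close>, while
      \<open>W1 \<union> W3\<close> avoids it.\<close>
    have "W1 \<union> W3 \<union> Z \<notin> \<H>"
    proof
      assume "W1 \<union> W3 \<union> Z \<in> \<H>"
      then obtain H' where H': "H' \<in> build gs" "W1 \<union> W3 \<union> Z = H' \<union> Z" by (auto simp: \<H>_def)
      then have "H' = W1 \<union> W3" using H(1)[OF H'(1)] WE EV(2) by blast
      then show False using H(3)[OF H'(1)] B(1) by auto
    qed
    moreover have "card (g ` (W1 \<union> Z) \<union> g ` (W3 \<union> Z)) = r"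
    proof -
      have "W1 \<union> W3 \<union> Z \<subseteq> V" using WE EV cardZ by blast
      then have "card (g ` (W1 \<union> W3 \<union> Z)) = card (W1 \<union> W3 \<union> Z)" by (intro card_image inj)
      also have "\<dots> = r" using card_Un_Z[of "W1 \<union> W3"] WE B(2) r_eq by simp
      also have "g ` (W1 \<union> W3 \<union> Z) = g ` (W1 \<union> Z) \<union> g ` (W3 \<union> Z)" by blast
      finally show ?thesis .
    qed
    moreover have "W1 \<union> W2 \<union> Z \<in> \<H>" "W2 \<union> W3 \<union> Z \<in> \<H>" using HW by (auto simp: \<H>_def)
    ultimately show ?thesis
      using lift[OF W(1)] lift[OF W(2)] lift[OF W(3)] un WE
      by (intro bexI[of _ "g ` (W1 \<union> Z)"] bexI[of _ "g ` (W2 \<union> Z)"] bexI[of _ "g ` (W3 \<union> Z)"]) auto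
  qed
  from counterexample[OF this] show ?thesis by blast
qed

end
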